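(* Let $M\subset\mathbb{R}^m$ be compact, let $F:\mathbb{R}^m\rightrightarrows\mathbb{R}^m$ be a standard set-valued map with induced set-valued dynamical system $\Phi$, and let $(x_n)_{n\ge0}$ be a generalised stochastic approximation process relative to $F$, with step sizes $(\gamma_n)_n$ and noise $(U_n)_n$, adapted to a filtration $(\mathcal{F}_n)_n$. Assume that there is a map $\omega$ with values in $\mathbb{R}_+$ such that, for all $\varepsilon>0$ and $T>0$, $\omega(n,\varepsilon,T)$ decreases to $0$ as $n\to+\infty$ and, for every $n$, almost surely $$\mathbb{P}\left(\sup_{k'\ge n}\ \sup_{k'<k\le m(\tau_{k'}+T)}\left\|\sum_{i=k'}^{k-1}\gamma_{i+1}U_{i+1}\right\|\ge\varepsilon\ \Big|\ \mathcal{F}_n\right)\le\omega(n,\varepsilon,T).$$ Let $X$ be the affine interpolated process of $(x_n)_n$. If $A$ is an attractor for $\Phi$ with basin of attraction $\mathcal{B}(A)$, then $$Att(X)\cap\mathcal{B}(A)\neq\emptyset\ \Rightarrow\ \mathbb{P}(\mathcal{L}(X)\subset A)>0.$$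
   Context: A set-valued map $F:\mathbb{R}^m\rightrightarrows\mathbb{R}^m$ is standard if: $F(x)$ is non-empty, compact and convex for every $x$; its graph is closed; there is $c>0$ with $\sup_{z\in F(x)}\|z\|\le c(1+\|x\|)$ for all $x$. For $\delta>0$, $F^\delta(x)=\{y:\exists z\in B(x,\delta)\text{ with } d(y,F(z))<\delta\}$. Generalised stochastic approximation process relative to $F$: $(U_n)_n$ is a uniformly bounded $\mathbb{R}^m$-valued random process, $(\gamma_n)_n$ a deterministic positive real sequence, $(F_n)_n$ a sequence of set-valued maps on $\mathbb{R}^m$, $(x_n)_n$ and $(U_n)_n$ are adapted to $(\mathcal{F}_n)_n$, and: (i) $x_{n+1}-x_n-\gamma_{n+1}U_{n+1}\in\gamma_{n+1}F_n(x_n)$; (ii) $\sum_n\gamma_n=+\infty$, $\lim_n\gamma_n=0$; (iii) for all $T>0$, almost surely $\lim_{n\to\infty}\sup\{\|\sum_{i=n}^{k-1}\gamma_{i+1}U_{i+1}\| : k\text{ such that }\sum_{i=n}^{k-1}\gamma_i\le T\}=0$; (iv) $x_n\in M$ for all $n\ge0$; (v) for any $\delta>0$ there is a (deterministic) $n_0\in\mathbb{N}$ such that $F_n(x_n)\subset F^\delta(x_n)$ for all $n\ge n_0$. A solution of $\dot{\mathbf{x}}\in F(\mathbf{x})$ is an absolutely continuous $\mathbf{x}:\mathbb{R}\to\mathbb{R}^m$ with $\dot{\mathbf{x}}(t)\in F(\mathbf{x}(t))$ for almost every $t$; $S_x$ is the set of solutions with $\mathbf{x}(0)=x$; $\Phi_t(x)=\{\mathbf{x}(t):\mathbf{x}\in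 S_x\}$, and $\Phi_t(U)$, $\Phi_I(x)$ denote the corresponding unions. A non-empty compact set $A$ is an attractor for $\Phi$ if it is invariant (for all $x\in A$ there is $\mathbf{x}\in S_x$ with $\mathbf{x}(\mathbb{R})\subset A$) and there is a neighborhood $U$ of $A$ such that for every $\epsilon>0$ there is $t_\epsilon>0$ with $\Phi_t(U)\subset N^\epsilon(A)$ ($\epsilon$-neighborhood) for all $t\ge t_\epsilon$. Its basin is $\mathcal{B}(A)=\{x:\Phi_{[0,+\infty[}(x)\text{ bounded and }\omega_\Phi(x)\subset A\}$, with $\omega_\Phi(x)=\bigcap_{t\ge0}\overline{\Phi_{[t,\infty[}(x)}$. Set $\tau_0=0$, $\tau_n=\sum_{i=1}^n\gamma_i$, $m(t)=\sup\{j:\tau_j\le t\}$. The affine interpolated process is $X(\tau_i+s)=x_i+s\frac{x_{i+1}-x_i}{\gamma_{i+1}}$ for $s\in[0,\gamma_{i+1}]$. Its limit set is $\mathcal{L}(X)=\bigcap_{t\ge0}\overline{\{X(s):s\ge t\}}$. A point $p\in M$ is attainable if for any $t>0$ and any neighborhood $U$ of $p$, $\mathbb{P}(\exists s\ge t:X(s)\in U)>0$; $Att(X)$ is the set of attainable points. A supremum over an empty set of norms is $0$. *)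

theory Defs
  imports "HOL-Probability.Probability"
begin

section \<open>Differential inclusions\<close>

definition standard_map :: "(real^'m \<Rightarrow> (real^'m) set) \<Rightarrow> bool" where
  "standard_map F \<longleftrightarrow>
     (\<forall>x. F x \<noteq> {} \<and> compact (F x) \<and> convex (F x)) \<and>
     closed {(x, y). y \<in> F x} \<and>
     (\<exists>c>0. \<forall>x. (SUP z\<in>F x. norm z) \<le> c * (1 + norm x))"

definition enlarge :: "(real^'m \<Rightarrow> (real^'m) set) \<Rightarrow> real \<Rightarrow> real^'m \<Rightarrow> (real^'m) set" where
  "enlarge F \<delta> x = {y. \<exists>z\<in>ball x \<delta>. infdist y (F z) < \<delta>}"

definition abs_cont_on_interval :: "real \<Rightarrow> real \<Rightarrow> (real \<Rightarrow> real^'m) \<Rightarrow> bool" where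
  "abs_cont_on_interval a b f \<longleftrightarrow>
     (\<forall>\<epsilon>>0. \<exists>\<delta>>0. \<forall>(N::nat) u v.
        (\<forall>i<N. a \<le> u i \<and> u i \<le> v i \<and> v i \<le> b) \<and>
        disjoint_family_on (\<lambda>i. {u i<..<v i}) {..<N} \<and>
        (\<Sum>i<N. v i - u i) < \<delta> \<longrightarrow>
        (\<Sum>i<N. norm (f (v i) - f (u i))) < \<epsilon>)"

text \<open>For a curve defined on the whole line, absolute continuity means absolute continuity on
  every compact interval, as usual for differential inclusions: the global version would
  exclude, for instance, the exponential as a solution of the linear equation
  with right-hand side the identity.\<close>

definition solution :: "(real^'m \<Rightarrow> (real^'m) set) \<Rightarrow> (real \<Rightarrow> real^'m) \<Rightarrow> bool" where
  "solution F x \<longleftrightarrow>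
     (\<forall>a b. abs_cont_on_interval a b x) \<and>
     (AE t in lborel. \<exists>v\<in>F (x t). (x has_vector_derivative v) (at t))"

definition solutions_from :: "(real^'m \<Rightarrow> (real^'m) set) \<Rightarrow> real^'m \<Rightarrow> (real \<Rightarrow> real^'m) set" where
  "solutions_from F p = {x. solution F x \<and> x 0 = p}"

definition flow :: "(real^'m \<Rightarrow> (real^'m) set) \<Rightarrow> real \<Rightarrow> real^'m \<Rightarrow> (real^'m) set" where
  "flow F t p = {x t | x. x \<in> solutions_from F p}"

definition omega_limit :: "(real^'m \<Rightarrow> (real^'m) set) \<Rightarrow> real^'m \<Rightarrow> (real^'m) set" where
  "omega_limit F p = (\<Inter>t\<in>{0..}. closure (\<Union>s\<in>{t..}. flow F s p))"

definition invariant :: "(real^'m \<Rightarrow> (real^'m) set) \<Rightarrow> (real^'m) set \<Rightarrow> bool" where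
  "invariant F A \<longleftrightarrow> (\<forall>p\<in>A. \<exists>x\<in>solutions_from F p. range x \<subseteq> A)"

definition attractor :: "(real^'m \<Rightarrow> (real^'m) set) \<Rightarrow> (real^'m) set \<Rightarrow> bool" where
  "attractor F A \<longleftrightarrow>
     A \<noteq> {} \<and> compact A \<and> invariant F A \<and>
     (\<exists>U. A \<subseteq> interior U \<and>
        (\<forall>\<epsilon>>0. \<exists>t\<^sub>\<epsilon>>0. \<forall>t\<ge>t\<^sub>\<epsilon>. (\<Union>p\<in>U. flow F t p) \<subseteq> {y. infdist y A < \<epsilon>}))"

definition basin :: "(real^'m \<Rightarrow> (real^'m) set) \<Rightarrow> (real^'m) set \<Rightarrow> (real^'m) set" where
  "basin F A = {p. bounded (\<Union>t\<in>{0..}. flow F t p) \<and> omega_limit F p \<subseteq> A}"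

section \<open>Generalised stochastic approximation processes\<close>

text \<open>The suprema of norms below are taken in the extended nonnegative reals, where the supremum
  of the empty set is \<open>0\<close>. Only the limit condition on the noise is an almost sure statement;
  the other relations hold at every sample point. The fifth argument \<open>G\<close> is the sequence of
  (deterministic) set-valued maps.\<close>

definition gen_stoch_approx ::
  "'w measure \<Rightarrow> (nat \<Rightarrow> 'w measure) \<Rightarrow> (real^'m) set \<Rightarrow> (real^'m \<Rightarrow> (real^'m) set) \<Rightarrow>
   (nat \<Rightarrow> real^'m \<Rightarrow> (real^'m) set) \<Rightarrow> (nat \<Rightarrow> real) \<Rightarrow>
   (nat \<Rightarrow> 'w \<Rightarrow> real^'m) \<Rightarrow> (nat \<Rightarrow> 'w \<Rightarrow> real^'m) \<Rightarrow> bool" where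
  "gen_stoch_approx P \<F> M F G \<gamma> U x \<longleftrightarrow>
     (\<exists>K. \<forall>n. \<forall>\<omega>\<in>space P. norm (U n \<omega>) \<le> K) \<and>
     (\<forall>n. \<gamma> n > 0) \<and>
     (\<forall>n. x n \<in> borel_measurable (\<F> n)) \<and>
     (\<forall>n. U n \<in> borel_measurable (\<F> n)) \<and>
     \<comment> \<open>(i)\<close>
     (\<forall>n. \<forall>\<omega>\<in>space P.
        x (Suc n) \<omega> - x n \<omega> - \<gamma> (Suc n) *\<^sub>R U (Suc n) \<omega>
          \<in> (\<lambda>z. \<gamma> (Suc n) *\<^sub>R z) ` G n (x n \<omega>)) \<and>
     \<comment> \<open>(ii)\<close>
     filterlim (\<lambda>n. \<Sum>i<n. \<gamma> i) at_top sequentially \<and> \<gamma> \<longlonglongrightarrow> 0 \<and>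
     \<comment> \<open>(iii)\<close>
     (\<forall>T>0. AE \<omega> in P.
        (\<lambda>n. SUP k\<in>{k. n \<le> k \<and> (\<Sum>i=n..<k. \<gamma> i) \<le> T}.
           ennreal (norm (\<Sum>i=n..<k. \<gamma> (Suc i) *\<^sub>R U (Suc i) \<omega>))) \<longlonglongrightarrow> 0) \<and>
     \<comment> \<open>(iv)\<close>
     (\<forall>n. \<forall>\<omega>\<in>space P. x n \<omega> \<in> M) \<and>
     \<comment> \<open>(v)\<close>
     (\<forall>\<delta>>0. \<exists>n\<^sub>0. \<forall>n\<ge>n\<^sub>0. \<forall>\<omega>\<in>space P. G n (x n \<omega>) \<subseteq> enlarge F \<delta> (x n \<omega>))"

definition step_time :: "(nat \<Rightarrow> real) \<Rightarrow> nat \<Rightarrow> real" where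
  "step_time \<gamma> n = (\<Sum>i=1..n. \<gamma> i)"

definition step_index :: "(nat \<Rightarrow> real) \<Rightarrow> real \<Rightarrow> nat" where
  "step_index \<gamma> t = Sup {j. step_time \<gamma> j \<le> t}"

text \<open>The defining property of the interpolated process is the lemma
  \<open>interpolated_step_time_add\<close> below; only times \<open>t \<ge> 0\<close> are meaningful.\<close>

definition interpolated ::
  "(nat \<Rightarrow> real) \<Rightarrow> (nat \<Rightarrow> 'w \<Rightarrow> real^'m) \<Rightarrow> 'w \<Rightarrow> real \<Rightarrow> real^'m" where
  "interpolated \<gamma> x \<omega> t =
     (let i = step_index \<gamma> t in
        x i \<omega> + ((t - step_time \<gamma> i) / \<gamma> (Suc i)) *\<^sub>R (x (Suc i) \<omega> - x i \<omega>))"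

definition limit_set :: "(real \<Rightarrow> real^'m) \<Rightarrow> (real^'m) set" where
  "limit_set X = (\<Inter>t\<in>{0..}. closure (X ` {t..}))"

text \<open>Neighbourhoods are taken open, so that the event is measurable (the paths being
  continuous).\<close>

definition attainable :: "'w measure \<Rightarrow> (real^'m) set \<Rightarrow> ('w \<Rightarrow> real \<Rightarrow> real^'m) \<Rightarrow> (real^'m) set" where
  "attainable P M X = {p\<in>M. \<forall>t>0. \<forall>V. open V \<and> p \<in> V \<longrightarrow>
     measure P {\<omega>\<in>space P. \<exists>s\<ge>t. X \<omega> s \<in> V} > 0}"

definition noise_event ::
  "'w measure \<Rightarrow> (nat \<Rightarrow> real) \<Rightarrow> (nat \<Rightarrow> 'w \<Rightarrow> real^'m) \<Rightarrow> nat \<Rightarrow> real \<Rightarrow> real \<Rightarrow> 'w set" where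
  "noise_event P \<gamma> U n \<epsilon> T = {\<omega>\<in>space P.
     (SUP k'\<in>{n..}. SUP k\<in>{k'<..step_index \<gamma> (step_time \<gamma> k' + T)}.
        ennreal (norm (\<Sum>i=k'..<k. \<gamma> (Suc i) *\<^sub>R U (Suc i) \<omega>))) \<ge> ennreal \<epsilon>}"

section \<open>Consistency of the encodings\<close>

lemma step_time_Suc: "step_time \<gamma> (Suc n) = step_time \<gamma> n + \<gamma> (Suc n)"
  by (simp add: step_time_def)

lemma step_index_eq:
  assumes pos: "\<And>n. \<gamma> n > 0" and lo: "step_time \<gamma> i \<le> t" and hi: "t < step_time \<gamma> (Suc i)"
  shows "step_index \<gamma> t = i"
proof -
  have mono: "mono (step_time \<gamma>)"
    using pos by (simp add: mono_iff_le_Suc step_time_Suc less_imp_le)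
  have "{j. step_time \<gamma> j \<le> t} = {..i}"
  proof (intro set_eqI iffI)
    fix j assume "j \<in> {j. step_time \<gamma> j \<le> t}"
    then show "j \<in> {..i}"
      using hi monoD[OF mono, of "Suc i" j] by (cases "j \<le> i") auto
  next
    fix j assume "j \<in> {..i}"
    then show "j \<in> {j. step_time \<gamma> j \<le> t}"
      using monoD[OF mono, of j i] lo by auto
  qed
  then show ?thesis
    by (simp add: step_index_def cSup_eq_Max)
qed

lemma interpolated_step_time_add:
  assumes pos: "\<And>n. \<gamma> n > 0" and s: "s \<in> {0..\<gamma> (Suc i)}"
  shows "interpolated \<gamma> x \<omega> (step_time \<gamma> i + s) =
    x i \<omega> + (s / \<gamma> (Suc i)) *\<^sub>R (x (Suc i) \<omega> - x i \<omega>)"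
proof (cases "s < \<gamma> (Suc i)")
  case True
  then have "step_index \<gamma> (step_time \<gamma> i + s) = i"
    using s by (intro step_index_eq[where \<gamma> = \<gamma>, OF pos]) (auto simp: step_time_Suc)
  then show ?thesis by (simp add: interpolated_def)
next
  case False
  then have s_eq: "s = \<gamma> (Suc i)" using s by simp
  have "step_index \<gamma> (step_time \<gamma> (Suc i)) = Suc i"
    using pos by (intro step_index_eq[where \<gamma> = \<gamma>, OF pos]) (auto simp: step_time_Suc)
  then show ?thesis
    using pos[of "Suc i"] by (simp add: interpolated_def s_eq flip: step_time_Suc)
qed

lemma sets_noise_event:
  assumes "\<And>n. U n \<in> borel_measurable P"
  shows "noise_event P \<gamma> U n \<epsilon> T \<in> sets P"
proof -
  note [measurable] = assms
  show ?thesis unfolding noise_event_def by measurable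
qed

end

theory Submission
  imports Defs "HOL-Complex_Analysis.Great_Picard"
begin

text \<open>A path of the process which starts late enough, with small noise over a finite horizon, follows
  a solution of the differential inclusion. This is proved by contradiction: a sequence of
  violating paths has a locally uniform limit, whose difference quotients approach the convex sets
  \<open>F (z t)\<close>; Lipschitz curves being differentiable almost everywhere, the limit is a solution.
  Hence a path which passes near a point of the basin enters the uniformly attracted neighbourhood of
  \<open>A\<close>, keeps returning to it as long as the noise stays small, and then converges to \<open>A\<close>.
  Attainability provides a late deterministic index \<open>n\<close> for which the path is near the
  point with positive probability; conditionally on \<open>\<F> n\<close>, the noise stays small with probability at least
  \<open>1 - w n \<epsilon> T > 0\<close>.\<close>

section \<open>Almost everywhere differentiability of Lipschitz curves\<close>

text \<open>The conditional bound on the noise speaks of one event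
  \<open>noise_event P \<gamma> U n e T\<close> with \<open>n\<close>, \<open>e\<close>,
  \<open>T\<close> fixed in advance. The thresholds of the path estimates must therefore be common
  to all sample points; the contradiction argument achieves this by letting the sample point vary
  along the violating sequence. For the same reason trapping and convergence are separated. Trapping
  near \<open>A\<close> takes noise below one fixed threshold over one fixed horizon, and this is
  what costs probability. Convergence takes thresholds tending to 0, and these come from the almost
  sure condition. A second obstacle is that solutions live on the whole line and are described by
  derivatives, whereas a limit of paths is at first a Lipschitz curve on a compact interval. It is
  extended forwards by limits of Euler polygons for \<open>F\<close> and backwards by those for the
  negative of \<open>F\<close>. Difference quotients over intervals around a time replace the
  derivative until the very end, as they survive limits, time shifts and time reversal.\<close>

definition bilipschitz :: "(real \<Rightarrow> real) \<Rightarrow> bool" where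
  "bilipschitz f \<longleftrightarrow> (\<exists>c>0. \<exists>L. \<forall>x y. x \<le> y \<longrightarrow> c * (y - x) \<le> f y - f x \<and> f y - f x \<le> L * (y - x))"

lemma bilipschitzI:
  assumes "c > 0" and "\<And>x y. x \<le> y \<Longrightarrow> c * (y - x) \<le> f y - f x"
    and "\<And>x y. x \<le> y \<Longrightarrow> f y - f x \<le> L * (y - x)"
  shows "bilipschitz f"
  using assms unfolding bilipschitz_def by blast

lemma bilipschitz_scale: "c > 0 \<Longrightarrow> bilipschitz (\<lambda>x. c * x)"
  by (rule bilipschitzI[of c _ c]) (auto simp: algebra_simps)

lemma bilipschitz_strict_mono:
  assumes "bilipschitz f" shows "strict_mono f"
proof
  fix x y :: real assume "x < y"
  with assms show "f x < f y"
    unfolding bilipschitz_def by (smt (verit) mult_pos_pos)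
qed

lemma bilipschitz_lipschitz:
  assumes "bilipschitz f"
  obtains L where "\<And>x y. \<bar>f y - f x\<bar> \<le> L * \<bar>y - x\<bar>"
proof -
  obtain c L where c: "c > 0" and *: "\<And>x y. x \<le> y \<Longrightarrow> c * (y - x) \<le> f y - f x \<and> f y - f x \<le> L * (y - x)"
    using assms unfolding bilipschitz_def by auto
  have "\<bar>f y - f x\<bar> \<le> L * \<bar>y - x\<bar>" for x y
  proof (cases "x \<le> y")
    case True
    moreover have "0 \<le> c * (y - x)" using True c by simp
    ultimately show ?thesis using *[OF True] by linarith
  next
    case False
    moreover have "0 \<le> c * (x - y)" using False c by simp
    moreover have "L * \<bar>y - x\<bar> = L * (x - y)" using False by simp
    ultimately show ?thesis using *[of y x] by linarith
  qed
  then show thesis using that by blast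
qed

lemma bilipschitz_continuous:
  assumes "bilipschitz f" shows "continuous_on S f"
proof -
  obtain L where "\<And>x y. \<bar>f y - f x\<bar> \<le> L * \<bar>y - x\<bar>"
    using bilipschitz_lipschitz[OF assms] by metis
  then have "(max L 0)-lipschitz_on UNIV f"
    unfolding lipschitz_on_def dist_real_def
    by (metis abs_ge_zero abs_minus_commute max.cobounded1 max.cobounded2 mult_right_mono order_trans)
  then show ?thesis
    using lipschitz_on_continuous_on continuous_on_subset by blast
qed

lemma bilipschitz_surj:
  assumes "bilipschitz f" shows "surj f"
proof -
  obtain c L where c: "c > 0" and *: "\<And>x y. x \<le> y \<Longrightarrow> c * (y - x) \<le> f y - f x"
    using assms unfolding bilipschitz_def by auto
  have "\<exists>x. f x = y" for y
  proof -
    define r where "r = \<bar>y - f 0\<bar> / c"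
    have r: "r \<ge> 0" "c * r = \<bar>y - f 0\<bar>" using c by (auto simp: r_def)
    have "f (- r) \<le> y" "y \<le> f r"
      using *[of 0 r] *[of "-r" 0] r by auto
    then show ?thesis
      using IVT'[of f "-r" y r] r bilipschitz_continuous[OF assms] by auto
  qed
  then show ?thesis by (metis surjI)
qed

text \<open>This is the benefit of increasing maps with a positive lower slope: the length of an
  image interval is an increment, so comparing increments compares measures.\<close>

lemma bilipschitz_image_interval:
  assumes "bilipschitz f" "a \<le> b" shows "f ` {a..b} = {f a..f b}"
proof -
  have m: "strict_mono f" by (rule bilipschitz_strict_mono[OF assms(1)])
  show ?thesis
  proof (intro equalityI subsetI)
    fix y assume "y \<in> {f a..f b}"
    moreover obtain x where "y = f x" using bilipschitz_surj[OF assms(1)] by (metis surjD)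
    ultimately show "y \<in> f ` {a..b}" using m by (auto simp: strict_mono_less_eq)
  qed (use m in \<open>auto simp: strict_mono_less_eq\<close>)
qed

text \<open>The image is a preimage under the inverse map, which the lower slope \<open>c\<close>
  makes Lipschitz with constant \<open>1/c\<close>.\<close>

lemma bilipschitz_image_borel:
  assumes f: "bilipschitz f" and E: "E \<in> sets borel"
  shows "f ` E \<in> sets borel"
proof -
  obtain c L where c: "c > 0" and *: "\<And>x y. x \<le> y \<Longrightarrow> c * (y - x) \<le> f y - f x"
    using f unfolding bilipschitz_def by auto
  have inj: "inj f" using bilipschitz_strict_mono[OF f] strict_mono_on_imp_inj_on by blast
  have "(1/c)-lipschitz_on UNIV (inv f)"
  proof (rule lipschitz_on_leI)
    fix x y :: real assume xy: "x \<le> y"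
    obtain u v where uv: "x = f u" "y = f v" using bilipschitz_surj[OF f] by (metis surjD)
    then have "u \<le> v" using bilipschitz_strict_mono[OF f] xy by (simp add: strict_mono_less_eq)
    then show "dist (inv f x) (inv f y) \<le> 1 / c * dist x y"
      using *[of u v] c uv xy by (simp add: inv_f_f[OF inj] dist_real_def field_simps)
  qed (use c in auto)
  then have "inv f \<in> borel_measurable borel"
    by (intro borel_measurable_continuous_onI lipschitz_on_continuous_on)
  then have "inv f -` E \<inter> space borel \<in> sets borel" using E by (rule measurable_sets)
  moreover have "inv f -` E \<inter> space borel = f ` E"
    using bij_vimage_eq_inv_image[of "inv f" E] bij_imp_bij_inv[of f] inj bilipschitz_surj[OF f]
    by (simp add: bij_def inv_inv_eq)
  ultimately show ?thesis by simp
qed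

text \<open>The intervals over which \<open>f\<close> grows at most as much as \<open>g\<close> form
  a Vitali cover of \<open>E\<close>. A countable disjoint subfamily exhausts \<open>E\<close> up to
  a negligible set, whose image under the Lipschitz map \<open>f\<close> is again negligible.
  Summing increments over the subfamily compares the two images.\<close>

lemma emeasure_image_le_if_increments_le:
  fixes f g :: "real \<Rightarrow> real"
  assumes f: "bilipschitz f" and g: "bilipschitz g" and E: "E \<in> sets borel"
    and inc: "\<And>t d. t \<in> E \<Longrightarrow> d > 0 \<Longrightarrow> \<exists>a b. a < t \<and> t < b \<and> b - a < d \<and> f b - f a \<le> g b - g a"
  shows "emeasure lborel (f ` E) \<le> emeasure lborel (g ` E)"
proof (rule ennreal_le_epsilon)
  fix e :: real assume e: "e > 0"
  note imgf = bilipschitz_image_interval[OF f] and imgg = bilipschitz_image_interval[OF g]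
  have gE: "g ` E \<in> sets borel" by (rule bilipschitz_image_borel[OF g E])
  \<comment> \<open>The excess \<open>e\<close> of \<open>O'\<close> over the image under
    \<open>g\<close> is the only loss in the estimate.\<close>
  obtain O' where O': "open O'" "g ` E \<subseteq> O'" "emeasure lborel (O' - g ` E) < ennreal e"
    using outer_regular_lborel[OF gE e] by metis
  have opO: "open (g -` O')" using O'(1) bilipschitz_continuous[OF g] by (simp add: open_vimage)
  define K where "K = {(a, b). a < b \<and> {a..b} \<subseteq> g -` O' \<and> f b - f a \<le> g b - g a}"
  \<comment> \<open>The covering theorem speaks of closed balls; midpoint and half length turn them
    into intervals indexed by pairs of endpoints.\<close>
  have cb: "cball ((fst i + snd i) / 2) ((snd i - fst i) / 2) = {fst i..snd i}" for i :: "real \<times> real"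
    by (auto simp: cball_def dist_real_def abs_if field_simps)
  obtain C where C: "countable C" "C \<subseteq> K"
      "pairwise (\<lambda>i j. disjnt {fst i..snd i} {fst j..snd j}) C"
      "negligible (E - (\<Union>i\<in>C. {fst i..snd i}))"
  proof (rule Vitali_covering_theorem_cballs[of K "\<lambda>i. (snd i - fst i) / 2" E "\<lambda>i. (fst i + snd i) / 2", unfolded cb])
    fix x d :: real assume x: "x \<in> E" and d: "0 < d"
    have "x \<in> g -` O'" using x O'(2) by auto
    then obtain h where h: "h > 0" "ball x h \<subseteq> g -` O'" using opO openE by blast
    \<comment> \<open>Length below \<open>min d h\<close> makes the interval both fine enough and
      contained in the preimage of \<open>O'\<close>.\<close>
    obtain a b where ab: "a < x" "x < b" "b - a < min d h" "f b - f a \<le> g b - g a"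
      using inc[OF x, of "min d h"] d h by auto
    have "{a..b} \<subseteq> ball x h" using ab by (auto simp: dist_real_def)
    then have "(a, b) \<in> K" using ab h by (auto simp: K_def)
    then show "\<exists>i. i \<in> K \<and> x \<in> {fst i..snd i} \<and> (snd i - fst i) / 2 < d"
      using ab d by (intro exI[of _ "(a,b)"]) auto
  qed (auto simp: K_def)
  define N where "N = E - (\<Union>i\<in>C. {fst i..snd i})"
  have CK: "a < b" "{a..b} \<subseteq> g -` O'" "f b - f a \<le> g b - g a" if "(a, b) \<in> C" for a b
    using that C(2) by (auto simp: K_def)
  have Nb: "N \<in> sets borel" unfolding N_def
    using C(1) E by (intro sets.Diff sets.countable_UN') auto
  obtain L where L: "\<And>x y. \<bar>f y - f x\<bar> \<le> L * \<bar>y - x\<bar>"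
    using bilipschitz_lipschitz[OF f] by blast
  have "negligible (f ` N)"
    using C(4) L unfolding N_def[symmetric]
    by (intro negligible_locally_Lipschitz_image) (auto intro!: exI[of _ UNIV])
  then have fN: "emeasure lborel (f ` N) = 0"
    using bilipschitz_image_borel[OF f Nb]
    by (simp add: negligible_iff_emeasure0)
  have disj: "disjoint_family_on (\<lambda>i. h ` {fst i..snd i}) C" if "inj h" for h :: "real \<Rightarrow> real"
    using C(3) that unfolding disjoint_family_on_def pairwise_def disjnt_def
    by (auto simp flip: image_Int)
  have em: "emeasure lborel (\<Union>i\<in>C. h ` {fst i..snd i}) = (\<integral>\<^sup>+i. emeasure lborel (h ` {fst i..snd i}) \<partial>count_space C)"
    if h: "bilipschitz h" for h :: "real \<Rightarrow> real"
  proof (rule emeasure_UN_countable[OF _ C(1) disj])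
    show "inj h" using bilipschitz_strict_mono[OF h] strict_mono_on_imp_inj_on by blast
    show "h ` {fst i..snd i} \<in> sets lborel" for i
      using bilipschitz_image_borel[OF h] by simp
  qed
  have UNb: "(\<Union>i\<in>C. h ` {fst i..snd i}) \<in> sets lborel" if h: "bilipschitz h" for h :: "real \<Rightarrow> real"
    by (intro sets.countable_UN'[OF C(1)]) (simp add: image_subset_iff bilipschitz_image_borel[OF h])
  have fNb: "f ` N \<in> sets lborel" using bilipschitz_image_borel[OF f Nb] by simp
  have "E \<subseteq> N \<union> (\<Union>i\<in>C. {fst i..snd i})" by (simp add: N_def)
  then have "f ` E \<subseteq> f ` N \<union> (\<Union>i\<in>C. f ` {fst i..snd i})" by blast
  then have "emeasure lborel (f ` E) \<le> emeasure lborel (f ` N \<union> (\<Union>i\<in>C. f ` {fst i..snd i}))"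
    by (rule emeasure_mono) (intro sets.Un fNb UNb f)
  also have "\<dots> \<le> emeasure lborel (f ` N) + emeasure lborel (\<Union>i\<in>C. f ` {fst i..snd i})"
    by (intro emeasure_subadditive fNb UNb f)
  also have "\<dots> = (\<integral>\<^sup>+i. emeasure lborel (f ` {fst i..snd i}) \<partial>count_space C)"
    by (simp add: fN em[OF f])
  also have "\<dots> \<le> (\<integral>\<^sup>+i. emeasure lborel (g ` {fst i..snd i}) \<partial>count_space C)"
  proof (rule nn_integral_mono)
    fix i assume "i \<in> space (count_space C)"
    then show "emeasure lborel (f ` {fst i..snd i}) \<le> emeasure lborel (g ` {fst i..snd i})"
      using CK[of "fst i" "snd i"] strict_monoD[OF bilipschitz_strict_mono[OF f], of "fst i" "snd i"]
        strict_monoD[OF bilipschitz_strict_mono[OF g], of "fst i" "snd i"]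
      by (auto simp: imgf imgg intro!: ennreal_leI)
  qed
  also have "\<dots> = emeasure lborel (\<Union>i\<in>C. g ` {fst i..snd i})" by (simp add: em[OF g])
  also have "\<dots> \<le> emeasure lborel O'"
    using CK(2) O'(1) by (intro emeasure_mono) fastforce+
  also have "\<dots> = emeasure lborel (g ` E \<union> (O' - g ` E))"
    using O'(2) by (intro arg_cong2[where f=emeasure]) auto
  also have "\<dots> \<le> emeasure lborel (g ` E) + emeasure lborel (O' - g ` E)"
    using gE O'(1) by (intro emeasure_subadditive) auto
  also have "\<dots> \<le> emeasure lborel (g ` E) + ennreal e"
    using O'(3) by (intro add_left_mono) simp
  finally show "emeasure lborel (f ` E) \<le> emeasure lborel (g ` E) + ennreal e" .
qed

text \<open>The previous lemma, applied to \<open>g\<close> and the two linear maps of slopes \<open>p < q\<close>, bounds the measure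
  of the image of the exceptional set from above by \<open>p\<close> and from below by \<open>q\<close> times its own measure.\<close>

lemma null_set_derivates:
  fixes g :: "real \<Rightarrow> real"
  assumes g: "bilipschitz g" and pq: "0 < p" "p < q"
  shows "{t. (\<forall>d>0. \<exists>a b. a < t \<and> t < b \<and> b - a < d \<and> g b - g a \<le> p * (b - a)) \<and>
             (\<forall>d>0. \<exists>a b. a < t \<and> t < b \<and> b - a < d \<and> q * (b - a) \<le> g b - g a)} \<in> null_sets lborel"
    (is "?E \<in> _")
proof -
  \<comment> \<open>\<open>D Q n\<close> is open as a union of open intervals, whatever
    \<open>Q\<close> is. Replacing \<open>d\<close> by \<open>1 / real (Suc n)\<close> thus exhibits
    the exceptional set as a countable intersection of open sets, hence as Borel.\<close>
  define D where "D Q n = (\<Union>(a, b)\<in>{(a, b). b - a < 1 / real (Suc n) \<and> Q a b}. {a<..<b})"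
    for Q :: "real \<Rightarrow> real \<Rightarrow> bool" and n
  have D: "(\<forall>d>0. \<exists>a b. a < t \<and> t < b \<and> b - a < d \<and> Q a b) \<longleftrightarrow> (\<forall>n. t \<in> D Q n)" for t Q
  proof safe
    fix n assume "\<forall>d>0. \<exists>a b. a < t \<and> t < b \<and> b - a < d \<and> Q a b"
    then obtain a b where "a < t \<and> t < b \<and> b - a < 1 / real (Suc n) \<and> Q a b"
      by (metis of_nat_0_less_iff zero_less_Suc zero_less_divide_1_iff)
    then show "t \<in> D Q n" by (auto simp: D_def)
  next
    fix d :: real assume *: "\<forall>n. t \<in> D Q n" and d: "d > 0"
    obtain n where n: "1 / real (Suc n) < d" using d nat_approx_posE by blast
    from * have "t \<in> D Q n" by blast
    then show "\<exists>a b. a < t \<and> t < b \<and> b - a < d \<and> Q a b"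
      using n unfolding D_def by fastforce
  qed
  have Db: "D Q n \<in> sets borel" for Q n
    unfolding D_def by (intro borel_open open_UN) auto
  have "?E = (\<Inter>n. D (\<lambda>a b. g b - g a \<le> p * (b - a)) n) \<inter> (\<Inter>n. D (\<lambda>a b. q * (b - a) \<le> g b - g a) n)"
    unfolding D by auto
  also have "\<dots> \<in> sets borel" using Db by auto
  finally have Eb: "?E \<in> sets borel" .
  \<comment> \<open>Cutting to a bounded interval makes the measure finite; for infinite measure the
    comparison of its \<open>q\<close>-fold with its \<open>p\<close>-fold would say
    nothing.\<close>
  have null: "?E \<inter> {-real R..real R} \<in> null_sets lborel" for R :: nat
  proof -
    define S where "S = ?E \<inter> {-real R..real R}"
    have S: "S \<in> sets borel" using Eb unfolding S_def by (intro sets.Int) auto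
    have sc: "emeasure lborel ((\<lambda>x. c * x) ` S) = ennreal c * emeasure lborel S" if "c > 0" for c
      using emeasure_lebesgue_affine[of c 0 S] that S bilipschitz_image_borel[OF bilipschitz_scale[OF that] S]
      by simp
    have 1: "emeasure lborel (g ` S) \<le> emeasure lborel ((\<lambda>x. p * x) ` S)"
      using pq by (intro emeasure_image_le_if_increments_le g bilipschitz_scale S) (auto simp: algebra_simps S_def)
    have 2: "emeasure lborel ((\<lambda>x. q * x) ` S) \<le> emeasure lborel (g ` S)"
      using pq by (intro emeasure_image_le_if_increments_le g bilipschitz_scale S) (auto simp: algebra_simps S_def)
    have le: "ennreal q * emeasure lborel S \<le> ennreal p * emeasure lborel S"
      using 1 2 pq by (simp add: sc)
    have "emeasure lborel S \<le> emeasure lborel {-real R..real R}"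
      by (intro emeasure_mono) (auto simp: S_def)
    then have fin: "emeasure lborel S < \<infinity>"
      by (simp add: order_le_less_trans)
    then obtain r where r: "emeasure lborel S = ennreal r" "r \<ge> 0"
      by (metis ennreal_cases infinity_ennreal_def less_irrefl)
    have "q * r \<le> p * r"
      using le r pq by (simp add: ennreal_mult[symmetric])
    then have "r = 0" using pq r by (smt (verit) mult_strict_right_mono)
    then show ?thesis using r S unfolding S_def[symmetric] by (auto simp: null_sets_def)
  qed
  have "?E = (\<Union>R. ?E \<inter> {-real R..real R})"
  proof (intro equalityI subsetI)
    fix t assume t: "t \<in> ?E"
    obtain R :: nat where "\<bar>t\<bar> \<le> real R" using real_arch_simple by blast
    then have "t \<in> {-real R..real R}" by auto
    then show "t \<in> (\<Union>R. ?E \<inter> {-real R..real R})" using t by blast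
  qed auto
  then show ?thesis
    using null_sets_UN[of "\<lambda>R::nat. ?E \<inter> {-real R..real R}" lborel] null by simp
qed


text \<open>If the lower and upper limits of the quotients over intervals straddling
  \<open>t\<close> differ, two rationals separate them and put \<open>t\<close> into one of the
  countably many null sets \<open>E p q\<close>. Elsewhere these quotients have a limit, and
  continuity of \<open>g\<close> carries it over to the one-sided quotients.\<close>

lemma bilipschitz_AE_differentiable:
  fixes g :: "real \<Rightarrow> real"
  assumes g: "bilipschitz g"
  shows "AE t in lborel. g differentiable (at t)"
proof -
  define E where "E p q = {t. (\<forall>d>0. \<exists>a b. a < t \<and> t < b \<and> b - a < d \<and> g b - g a \<le> p * (b - a)) \<and>
             (\<forall>d>0. \<exists>a b. a < t \<and> t < b \<and> b - a < d \<and> q * (b - a) \<le> g b - g a)}" for p q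
  have "(\<Union>p\<in>{p\<in>\<rat>. 0 < p}. \<Union>q\<in>{q\<in>\<rat>. p < q}. E p q) \<in> null_sets lborel" (is "?N \<in> _")
    unfolding E_def
    by (intro null_sets_UN' countable_subset[OF _ countable_rat] null_set_derivates g) auto
  then have "AE t in lborel. t \<notin> ?N" by (rule AE_not_in)
  then show ?thesis
  proof (rule AE_mp, intro AE_I2 impI)
    fix t assume "t \<notin> ?N"
    then have notE: "t \<notin> E p q" if "p \<in> \<rat>" "q \<in> \<rat>" "0 < p" "p < q" for p q
      using that by blast
    obtain c L where c: "c > 0" and lo: "\<And>x y. x \<le> y \<Longrightarrow> c * (y - x) \<le> g y - g x"
      and up: "\<And>x y. x \<le> y \<Longrightarrow> g y - g x \<le> L * (y - x)"
      using g unfolding bilipschitz_def by auto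
    \<comment> \<open>\<open>S\<close> collects the slopes that are eventually strict lower bounds
      of the straddling quotients, so its supremum \<open>D\<close> is their lower limit.\<close>
    define S where "S = {p. \<exists>d>0. \<forall>a b. a < t \<and> t < b \<and> b - a < d \<longrightarrow> p * (b - a) < g b - g a}"
    have 0: "0 \<in> S"
      using strict_monoD[OF bilipschitz_strict_mono[OF g]] by (auto simp: S_def intro!: exI[of _ 1])
    have ub: "p \<le> L" if p: "p \<in> S" for p
    proof -
      obtain d where d: "d > 0" "\<And>a b. a < t \<Longrightarrow> t < b \<Longrightarrow> b - a < d \<Longrightarrow> p * (b - a) < g b - g a"
        using p unfolding S_def by blast
      have "p * (d/2) < g (t + d/4) - g (t - d/4)" using d(2)[of "t - d/4" "t + d/4"] d(1) by simp
      also have "\<dots> \<le> L * (d/2)" using up[of "t - d/4" "t + d/4"] d(1) by simp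
      finally show ?thesis using d(1) by simp
    qed
    then have bdd: "bdd_above S" by (rule bdd_aboveI)
    define D where "D = Sup S"
    have D0: "0 \<le> D" unfolding D_def by (rule cSup_upper[OF 0 bdd])
    have near: "\<exists>d>0. \<forall>s. s \<noteq> t \<and> \<bar>s - t\<bar> < d \<longrightarrow> \<bar>(g s - g t) / (s - t) - D\<bar> \<le> e" if e: "e > 0" for e
    proof -
      obtain p where p: "p \<in> S" "D - e < p"
        using less_cSup_iff[of S "D - e"] 0 bdd e unfolding D_def by auto
      then obtain d1 where d1: "d1 > 0" "\<And>a b. a < t \<Longrightarrow> t < b \<Longrightarrow> b - a < d1 \<Longrightarrow> p * (b - a) < g b - g a"
        unfolding S_def by blast
      \<comment> \<open>Two rationals above \<open>D\<close> are chosen: as \<open>q1\<close> is not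
        in \<open>S\<close>, quotients of at most \<open>q1\<close> occur at all scales, and since
        \<open>t\<close> is outside \<open>E q1 q2\<close>, quotients of at least \<open>q2\<close>
        do not.\<close>
      obtain q1 where q1: "q1 \<in> \<rat>" "D < q1" "q1 < D + e"
        using Rats_dense_in_real[of D "D + e"] e by auto
      obtain q2 where q2: "q2 \<in> \<rat>" "q1 < q2" "q2 < D + e"
        using Rats_dense_in_real[of q1 "D + e"] q1 by auto
      have "q1 \<notin> S" using q1(2) cSup_upper[OF _ bdd] unfolding D_def by force
      then have "\<forall>d>0. \<exists>a b. a < t \<and> t < b \<and> b - a < d \<and> g b - g a \<le> q1 * (b - a)"
        unfolding S_def mem_Collect_eq by (meson not_le)
      then have "\<not> (\<forall>d>0. \<exists>a b. a < t \<and> t < b \<and> b - a < d \<and> q2 * (b - a) \<le> g b - g a)"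
        using notE[of q1 q2] q1 q2 D0 unfolding E_def by auto
      then obtain d2 where d2: "d2 > 0" "\<And>a b. a < t \<Longrightarrow> t < b \<Longrightarrow> b - a < d2 \<Longrightarrow> g b - g a < q2 * (b - a)"
        by (metis not_le)
      define d where "d = min d1 d2"
      have d: "\<bar>g b - g a - D * (b - a)\<bar> \<le> e * (b - a)" if ab: "a < t" "t < b" "b - a < d" for a b
      proof -
        have "(D - e) * (b - a) \<le> p * (b - a)" "q2 * (b - a) \<le> (D + e) * (b - a)"
          using p q2 ab by (auto intro!: mult_right_mono)
        then show ?thesis
          using d1(2)[of a b] d2(2)[of a b] ab by (simp add: d_def algebra_simps abs_le_iff)
      qed
      have cont: "isCont g x" for x
        using bilipschitz_continuous[OF g, of UNIV] by (simp add: continuous_on_eq_continuous_at)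
      have "\<bar>(g s - g t) / (s - t) - D\<bar> \<le> e" if s: "s \<noteq> t" "\<bar>s - t\<bar> < d" for s
      proof -
        \<comment> \<open>The bound \<open>d\<close> asks for endpoints strictly on both sides of
          \<open>t\<close>; the endpoint opposite to \<open>s\<close> is sent to
          \<open>t\<close>.\<close>
        have "\<bar>g s - g t - D * (s - t)\<bar> \<le> e * \<bar>s - t\<bar>"
        proof (cases "t < s")
          case True
          have "((\<lambda>a. \<bar>g s - g a - D * (s - a)\<bar>) \<longlongrightarrow> \<bar>g s - g t - D * (s - t)\<bar>) (at_left t)"
            using cont[of t] by (intro tendsto_intros) (simp add: isCont_def tendsto_within_subset[where S=UNIV])
          moreover have "((\<lambda>a. e * (s - a)) \<longlongrightarrow> e * (s - t)) (at_left t)"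
            by (intro tendsto_intros)
          moreover have "\<forall>\<^sub>F a in at_left t. s - d < a \<and> a < t"
            using eventually_at_left_real[of "s - d" t] s True by (auto simp: greaterThanLessThan_iff)
          then have "\<forall>\<^sub>F a in at_left t. \<bar>g s - g a - D * (s - a)\<bar> \<le> e * (s - a)"
            by eventually_elim (use d True in auto)
          ultimately show ?thesis using True tendsto_le[OF trivial_limit_at_left_real] by fastforce
        next
          case False
          have "((\<lambda>b. \<bar>g b - g s - D * (b - s)\<bar>) \<longlongrightarrow> \<bar>g t - g s - D * (t - s)\<bar>) (at_right t)"
            using cont[of t] by (intro tendsto_intros) (simp add: isCont_def tendsto_within_subset[where S=UNIV])
          moreover have "((\<lambda>b. e * (b - s)) \<longlongrightarrow> e * (t - s)) (at_right t)"
            by (intro tendsto_intros)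
          moreover have "\<forall>\<^sub>F b in at_right t. t < b \<and> b < s + d"
            using eventually_at_right_real[of t "s + d"] s False by (auto simp: greaterThanLessThan_iff)
          then have "\<forall>\<^sub>F b in at_right t. \<bar>g b - g s - D * (b - s)\<bar> \<le> e * (b - s)"
            by eventually_elim (use d False s in auto)
          ultimately have "\<bar>g t - g s - D * (t - s)\<bar> \<le> e * (t - s)"
            using tendsto_le[OF trivial_limit_at_right_real] by blast
          then show ?thesis using False by (simp add: algebra_simps abs_if split: if_splits)
        qed
        moreover have "(g s - g t) / (s - t) - D = (g s - g t - D * (s - t)) / (s - t)"
          using s by (simp add: field_simps)
        ultimately show ?thesis using s by (simp add: abs_divide divide_le_eq)
      qed
      then show ?thesis using d1(1) d2(1) by (auto simp: d_def intro!: exI[of _ d])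
    qed
    have "((\<lambda>s. (g s - g t) / (s - t)) \<longlongrightarrow> D) (at t)"
      unfolding LIM_eq
    proof (intro allI impI)
      fix r :: real assume "0 < r"
      then obtain d where "d > 0" and d: "\<And>s. s \<noteq> t \<Longrightarrow> \<bar>s - t\<bar> < d \<Longrightarrow> \<bar>(g s - g t) / (s - t) - D\<bar> \<le> r / 2"
        using near[of "r/2"] by auto
      moreover have "\<bar>(g s - g t) / (s - t) - D\<bar> < r" if "s \<noteq> t" "\<bar>s - t\<bar> < d" for s
        using d[OF that] \<open>0 < r\<close> by linarith
      ultimately show "\<exists>s>0. \<forall>x. x \<noteq> t \<and> norm (x - t) < s \<longrightarrow> norm ((g x - g t) / (x - t) - D) < r"
        by (intro exI[of _ d]) auto
    qed
    then show "g differentiable (at t)"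
      unfolding has_field_derivative_iff[symmetric]
      using real_differentiable_def by blast
  qed
qed

lemma lipschitz_AE_differentiable:
  fixes f :: "real \<Rightarrow> 'a::euclidean_space"
  assumes "L-lipschitz_on UNIV f"
  shows "AE t in lborel. f differentiable (at t)"
proof -
  have "AE t in lborel. (\<lambda>t. f t \<bullet> b) differentiable (at t)" if b: "b \<in> Basis" for b
  proof -
    have L: "\<bar>f y \<bullet> b - f x \<bullet> b\<bar> \<le> L * \<bar>y - x\<bar>" for x y
      using lipschitz_onD[OF assms, of y x] Basis_le_norm[OF b, of "f y - f x"]
      by (simp add: dist_norm inner_diff_left)
    \<comment> \<open>adding a steep linear map makes the component increasing and bilipschitz\<close>
    have "bilipschitz (\<lambda>t. f t \<bullet> b + (L + 1) * t)"
    proof (rule bilipschitzI[of 1 _ "2 * L + 1"])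
      fix x y :: real assume xy: "x \<le> y"
      then have "\<bar>f y \<bullet> b - f x \<bullet> b\<bar> \<le> L * (y - x)" using L[of y x] by simp
      then show "1 * (y - x) \<le> f y \<bullet> b + (L + 1) * y - (f x \<bullet> b + (L + 1) * x)"
        "f y \<bullet> b + (L + 1) * y - (f x \<bullet> b + (L + 1) * x) \<le> (2 * L + 1) * (y - x)"
        by (auto simp: algebra_simps abs_le_iff)
    qed simp
    then have "AE t in lborel. (\<lambda>t. f t \<bullet> b + (L + 1) * t) differentiable (at t)"
      by (rule bilipschitz_AE_differentiable)
    then show ?thesis
    proof (rule AE_mp, intro AE_I2 impI)
      fix t assume "(\<lambda>t. f t \<bullet> b + (L + 1) * t) differentiable (at t)"
      then have "(\<lambda>t. (f t \<bullet> b + (L + 1) * t) - (L + 1) * t) differentiable (at t)"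
        by (intro differentiable_diff) (auto intro: derivative_intros)
      then show "(\<lambda>t. f t \<bullet> b) differentiable (at t)" by simp
    qed
  qed
  then have "AE t in lborel. \<forall>b\<in>Basis. (\<lambda>t. f t \<bullet> b) differentiable (at t)"
    by (intro AE_ball_countable' countable_finite) auto
  then show ?thesis
    by (rule AE_mp) (auto intro!: AE_I2 simp: differentiable_componentwise_within[of f _ UNIV])
qed

text \<open>Clamping the time to \<open>{-real n..real n}\<close> gives a globally Lipschitz curve
  which agrees with \<open>f\<close> near each interior time.\<close>

lemma locally_lipschitz_AE_differentiable:
  fixes f :: "real \<Rightarrow> 'a::euclidean_space"
  assumes "\<And>T. \<exists>L. L-lipschitz_on {-T..T} f"
  shows "AE t in lborel. f differentiable (at t)"
proof -
  have "AE t in lborel. t \<in> {-real n<..<real n} \<longrightarrow> f differentiable (at t)" for n :: nat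
  proof -
    define h where "h t = f (max (- real n) (min (real n) t))" for t
    obtain L where L: "L-lipschitz_on {-real n..real n} f" using assms by blast
    have "L-lipschitz_on UNIV h"
    proof (rule lipschitz_on_leI)
      fix x y :: real assume "x \<le> y"
      have "dist (h x) (h y) \<le> L * dist (max (- real n) (min (real n) x)) (max (- real n) (min (real n) y))"
        unfolding h_def by (intro lipschitz_onD[OF L]) auto
      also have "\<dots> \<le> L * dist x y"
        using lipschitz_on_nonneg[OF L] by (intro mult_left_mono) (auto simp: dist_real_def)
      finally show "dist (h x) (h y) \<le> L * dist x y" .
    qed (rule lipschitz_on_nonneg[OF L])
    then have "AE t in lborel. h differentiable (at t)"
      by (rule lipschitz_AE_differentiable)
    then show ?thesis
    proof (rule AE_mp, intro AE_I2 impI)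
      fix t assume h: "h differentiable (at t)" and t: "t \<in> {-real n<..<real n}"
      show "f differentiable (at t)"
        using h t unfolding differentiable_def
        by (auto intro!: has_derivative_transform_within_open[of h _ t UNIV "{-real n<..<real n}" f]
          simp: h_def min_def max_def)
    qed
  qed
  then have "\<forall>n::nat. AE t in lborel. t \<in> {-real n<..<real n} \<longrightarrow> f differentiable (at t)"
    by (rule allI)
  then have "AE t in lborel. \<forall>n::nat. t \<in> {-real n<..<real n} \<longrightarrow> f differentiable (at t)"
    unfolding AE_all_countable .
  then show ?thesis
  proof (rule AE_mp, intro AE_I2 impI)
    fix t assume *: "\<forall>n::nat. t \<in> {-real n<..<real n} \<longrightarrow> f differentiable (at t)"
    obtain n :: nat where "\<bar>t\<bar> < real n" using reals_Archimedean2 by blast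
    then show "f differentiable (at t)" using * by (auto simp: abs_less_iff)
  qed
qed

section \<open>Solutions through difference quotients\<close>

lemma standard_map_growth:
  assumes "standard_map F"
  obtains c where "c > 0" "\<And>x z. z \<in> F x \<Longrightarrow> norm z \<le> c * (1 + norm x)"
proof -
  obtain c where c: "c > 0" "\<And>x. (SUP z\<in>F x. norm z) \<le> c * (1 + norm x)"
    using assms unfolding standard_map_def by auto
  have "norm z \<le> c * (1 + norm x)" if z: "z \<in> F x" for x z
  proof -
    \<comment> \<open>The growth condition bounds a real supremum, which dominates the single norms
      only once they are known to be bounded above.\<close>
    have "compact (F x)" using assms unfolding standard_map_def by blast
    then have "bdd_above (norm ` F x)"
      by (intro bounded_imp_bdd_above compact_imp_bounded compact_continuous_image continuous_intros)
    then have "norm z \<le> (SUP z\<in>F x. norm z)" by (rule cSUP_upper[OF z])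
    then show ?thesis using c(2)[of x] by simp
  qed
  then show thesis using that c(1) by blast
qed

lemma standard_map_values:
  assumes "standard_map F"
  shows "F x \<noteq> {}" "compact (F x)" "convex (F x)" "closed (F x)"
  using assms unfolding standard_map_def by (auto intro: compact_imp_closed)

text \<open>Reversing time turns the inclusion for \<open>F\<close> into the one for its negative;
  forward existence thereby also covers negative times.\<close>

lemma standard_map_uminus:
  assumes "standard_map F"
  shows "standard_map (\<lambda>x. uminus ` F x)"
proof -
  have "{(x, y). y \<in> uminus ` F x} = (\<lambda>(x, y). (x, - y)) -` {(x, y). y \<in> F x}"
    by (auto simp: image_iff) (metis minus_minus)
  moreover have "closed ((\<lambda>(x, y). (x, - y)) -` {(x, y). y \<in> F x})"
    using assms unfolding standard_map_def
    by (intro closed_vimage) (auto simp: case_prod_unfold intro!: continuous_intros)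
  ultimately show ?thesis
    using assms unfolding standard_map_def
    by (auto simp: image_image compact_negations convex_negations)
qed

text \<open>Upper semicontinuity in a form that tolerates the enlargement. A violating sequence
  yields \<open>z n\<close> tending to \<open>x\<close> and \<open>w n\<close> in
  \<open>F (z n)\<close>; the growth bound keeps \<open>w\<close> bounded, and the closed graph puts
  a cluster point into \<open>F x\<close>, nearer to some \<open>v n\<close> than \<open>e\<close>
  allows.\<close>

lemma standard_map_usc:
  fixes F :: "real^'m \<Rightarrow> (real^'m) set"
  assumes F: "standard_map F" and e: "e > 0"
  shows "\<exists>r>0. \<forall>y. dist y x < r \<longrightarrow> enlarge F r y \<subseteq> {v. infdist v (F x) \<le> e}"
proof (rule ccontr)
  assume "\<not> ?thesis"
  then have no: "\<not> (\<forall>y. dist y x < r \<longrightarrow> enlarge F r y \<subseteq> {v. infdist v (F x) \<le> e})" if "r > 0" for r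
    using that by blast
  have "\<exists>y v. dist y x < r \<and> v \<in> enlarge F r y \<and> e < infdist v (F x)" if "r > 0" for r
    using no[OF that] by (auto simp: subset_eq not_le)
  then have "\<exists>y v. dist y x < 1 / real (Suc n) \<and> v \<in> enlarge F (1 / real (Suc n)) y \<and> e < infdist v (F x)" for n
    by simp
  then obtain y v where yv: "\<And>n. dist (y n) x < 1 / real (Suc n)"
      "\<And>n. v n \<in> enlarge F (1 / real (Suc n)) (y n)" "\<And>n. e < infdist (v n) (F x)"
    by metis
  have "\<exists>z w. dist (y n) z < 1 / real (Suc n) \<and> w \<in> F z \<and> dist (v n) w < 1 / real (Suc n)" for n
  proof -
    obtain z where z: "dist (y n) z < 1 / real (Suc n)" "infdist (v n) (F z) < 1 / real (Suc n)"
      using yv(2)[of n] by (auto simp: enlarge_def)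
    moreover obtain w where "w \<in> F z" "infdist (v n) (F z) = dist (v n) w"
      using infdist_attains_inf[of "F z" "v n"] standard_map_values[OF F, of z] by auto
    ultimately show ?thesis by metis
  qed
  then obtain z w where zw: "\<And>n. dist (y n) (z n) < 1 / real (Suc n)" "\<And>n. w n \<in> F (z n)"
      "\<And>n. dist (v n) (w n) < 1 / real (Suc n)"
    by metis
  have null: "(\<lambda>n. 1 / real (Suc n)) \<longlonglongrightarrow> 0"
    using LIMSEQ_inverse_real_of_nat by (simp add: inverse_eq_divide)
  have sq: "f \<longlonglongrightarrow> 0" if "\<And>n. 0 \<le> f n" "\<And>n. f n < 1 / real (Suc n)" for f :: "nat \<Rightarrow> real"
    using that by (intro tendsto_sandwich[OF _ _ tendsto_const null] always_eventually allI) (auto intro: less_imp_le simp del: of_nat_Suc)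
  have "(\<lambda>n. dist (y n) (z n)) \<longlonglongrightarrow> 0" "(\<lambda>n. dist (y n) x) \<longlonglongrightarrow> 0"
    by (rule sq; use zw(1) yv(1) in simp)+
  then have lim: "(\<lambda>n. dist (y n) x + dist (y n) (z n)) \<longlonglongrightarrow> 0"
    using tendsto_add by fastforce
  have "(\<lambda>n. dist (z n) x) \<longlonglongrightarrow> 0"
    by (rule tendsto_sandwich[OF _ _ tendsto_const lim])
      (use dist_triangle[of "z n" x "y n" for n] in \<open>auto intro!: always_eventually simp: dist_commute add.commute\<close>)
  then have z: "z \<longlonglongrightarrow> x" by (rule tendsto_dist_iff[THEN iffD2])
  obtain c where c: "c > 0" "\<And>x z. z \<in> F x \<Longrightarrow> norm z \<le> c * (1 + norm x)"
    using standard_map_growth[OF F] by blast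
  obtain B where B: "\<And>n. norm (z n) \<le> B"
    using z by (meson Bseq_def convergentI convergent_imp_Bseq)
  have "norm (w n) \<le> c * (1 + B)" for n
    using c(2)[OF zw(2)[of n]] mult_left_mono[of "1 + norm (z n)" "1 + B" c] B[of n] c(1) by linarith
  then have "bounded (range w)" by (auto simp: bounded_iff)
  then obtain l k where k: "strict_mono k" "(w \<circ> k) \<longlonglongrightarrow> l"
    using bounded_imp_convergent_subsequence by blast
  have "closed {(x, y). y \<in> F x}" using F unfolding standard_map_def by blast
  moreover have "(\<lambda>n. (z (k n), w (k n))) \<longlonglongrightarrow> (x, l)"
    using LIMSEQ_subseq_LIMSEQ[OF z k(1)] k(2) by (intro tendsto_Pair) (auto simp: o_def)
  moreover have "(z (k n), w (k n)) \<in> {(x, y). y \<in> F x}" for n using zw(2) by auto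
  ultimately have "(x, l) \<in> {(x, y). y \<in> F x}" by (meson closed_sequentially)
  then have l: "l \<in> F x" by simp
  have "(\<lambda>n. 1 / real (Suc (k n)) + dist (w (k n)) l) \<longlonglongrightarrow> 0 + 0"
    using tendsto_dist_iff[THEN iffD1, OF k(2)] LIMSEQ_subseq_LIMSEQ[OF null k(1)]
    by (intro tendsto_add) (auto simp: o_def)
  then have "\<forall>\<^sub>F n in sequentially. 1 / real (Suc (k n)) + dist (w (k n)) l < e"
    using e by (intro order_tendstoD) auto
  then obtain n where n: "1 / real (Suc (k n)) + dist (w (k n)) l < e"
    by (auto simp: eventually_sequentially)
  have "infdist (v (k n)) (F x) \<le> dist (v (k n)) l" by (rule infdist_le[OF l])
  also have "\<dots> \<le> dist (v (k n)) (w (k n)) + dist (w (k n)) l" by (rule dist_triangle)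
  also have "\<dots> < e" using n zw(3)[of "k n"] by linarith
  finally show False using yv(3)[of "k n"] by simp
qed

lemma infdist_le_iff_exists:
  fixes S :: "'a::heine_borel set"
  assumes "closed S" "S \<noteq> {}"
  shows "infdist x S \<le> e \<longleftrightarrow> (\<exists>y\<in>S. dist x y \<le> e)"
proof -
  obtain y where "y \<in> S" "infdist x S = dist x y"
    using infdist_attains_inf[OF assms] by blast
  then show ?thesis using infdist_le2 by metis
qed

text \<open>These neighbourhoods of a value of \<open>F\<close> are the convex test sets to which
  \<open>almost_inclusion\<close> is applied.\<close>

lemma convex_infdist_le:
  fixes S :: "'a::euclidean_space set"
  assumes "convex S" "closed S" "S \<noteq> {}"
  shows "convex {v. infdist v S \<le> e}"
proof (rule convexI)
  fix x y u v :: "'a" and a b :: real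
  assume x: "x \<in> {v. infdist v S \<le> e}" and y: "y \<in> {v. infdist v S \<le> e}"
    and uv: "0 \<le> a" "0 \<le> b" "a + b = 1"
  obtain x' y' where x': "x' \<in> S" "norm (x - x') \<le> e" and y': "y' \<in> S" "norm (y - y') \<le> e"
    using x y infdist_le_iff_exists[OF assms(2,3)] by (auto simp: dist_norm)
  have "(a *\<^sub>R x + b *\<^sub>R y) - (a *\<^sub>R x' + b *\<^sub>R y') = a *\<^sub>R (x - x') + b *\<^sub>R (y - y')"
    by (simp add: algebra_simps)
  then have "norm ((a *\<^sub>R x + b *\<^sub>R y) - (a *\<^sub>R x' + b *\<^sub>R y')) \<le> a * norm (x - x') + b * norm (y - y')"
    using uv by (metis norm_triangle_ineq norm_scaleR abs_of_nonneg)
  also have "\<dots> \<le> a * e + b * e" using x' y' uv by (intro add_mono mult_left_mono) auto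
  also have "\<dots> = e" using uv by (simp flip: distrib_right)
  finally show "a *\<^sub>R x + b *\<^sub>R y \<in> {v. infdist v S \<le> e}"
    using infdist_le_iff_exists[OF assms(2,3)] convexD[OF assms(1) x'(1) y'(1) uv]
    by (auto simp: dist_norm)
qed

text \<open>For a locally Lipschitz curve this condition, which involves no derivative and is stable under
  limits because the values are convex, suffices to be a solution, even if it fails at finitely many times.\<close>

definition quotients_approach :: "(real^'m \<Rightarrow> (real^'m) set) \<Rightarrow> (real \<Rightarrow> real^'m) \<Rightarrow> real \<Rightarrow> bool" where
  "quotients_approach F z t \<longleftrightarrow> (\<forall>e>0. \<exists>d>0. \<forall>s s'. t - d < s \<and> s \<le> t \<and> t \<le> s' \<and> s' < t + d \<and> s < s' \<longrightarrow>
     infdist ((z s' - z s) /\<^sub>R (s' - s)) (F (z t)) \<le> e)"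

text \<open>Taking \<open>s = t\<close> gives right-hand quotients, close both to \<open>v\<close>
  and to \<open>F (z t)\<close>; closedness of the value turns distance 0 into membership.\<close>

lemma derivative_in_if_quotients_approach:
  assumes F: "standard_map F" and q: "quotients_approach F z t" and D: "(z has_vector_derivative v) (at t)"
  shows "v \<in> F (z t)"
proof -
  have "infdist v (F (z t)) \<le> 2 * e" if e: "e > 0" for e
  proof -
    obtain d where d: "d > 0" "\<And>s'. t < s' \<Longrightarrow> s' < t + d \<Longrightarrow> infdist ((z s' - z t) /\<^sub>R (s' - t)) (F (z t)) \<le> e"
      using q e unfolding quotients_approach_def by (smt (verit, best))
    have "\<forall>\<^sub>F s in at t. norm (z s - z t - (s - t) *\<^sub>R v) \<le> e * norm (s - t)"
      using D e unfolding has_vector_derivative_def has_derivative_within_alt2 by blast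
    then obtain d' where d': "d' > 0" "\<And>s. s \<noteq> t \<Longrightarrow> \<bar>s - t\<bar> < d' \<Longrightarrow> norm (z s - z t - (s - t) *\<^sub>R v) \<le> e * \<bar>s - t\<bar>"
      unfolding eventually_at by (auto simp: dist_real_def)
    define h where "h = min d d' / 2"
    have h: "h > 0" "h < d" "h < d'" using d(1) d'(1) by (auto simp: h_def)
    have "v - (z (t + h) - z t) /\<^sub>R h = - ((z (t + h) - z t - h *\<^sub>R v) /\<^sub>R h)"
      using h by (simp add: algebra_simps)
    then have "dist v ((z (t + h) - z t) /\<^sub>R h) = norm (z (t + h) - z t - h *\<^sub>R v) / h"
      using h by (simp add: dist_norm divide_inverse mult.commute)
    also have "\<dots> \<le> e" using d'(2)[of "t + h"] h by (simp add: divide_le_eq)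
    finally have "dist v ((z (t + h) - z t) /\<^sub>R h) \<le> e" .
    moreover have "infdist ((z (t + h) - z t) /\<^sub>R h) (F (z t)) \<le> e" using d(2)[of "t + h"] h by simp
    ultimately show ?thesis
      using infdist_triangle[of v "F (z t)" "(z (t + h) - z t) /\<^sub>R h"] by linarith
  qed
  then have "infdist v (F (z t)) \<le> 0 + e" if "e > 0" for e
    using that by (metis field_sum_of_halves half_gt_zero_iff mult_2 add_0)
  then have "infdist v (F (z t)) \<le> 0"
    by (rule field_le_epsilon)
  then have "infdist v (F (z t)) = 0" using infdist_nonneg by (rule antisym)
  then show ?thesis
    using standard_map_values[OF F] by (simp add: in_closed_iff_infdist_zero)
qed

lemma lipschitz_abs_cont_on_interval:
  assumes "L-lipschitz_on {a..b} f"
  shows "abs_cont_on_interval a b f"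
  unfolding abs_cont_on_interval_def
proof (intro allI impI)
  fix e :: real assume e: "e > 0"
  have L: "L \<ge> 0" using assms by (rule lipschitz_on_nonneg)
  have "(\<Sum>i<N. norm (f (v i) - f (u i))) < e"
    if "\<forall>i<N. a \<le> u i \<and> u i \<le> v i \<and> v i \<le> b" "(\<Sum>i<N. v i - u i) < e / (L + 1)" for N :: nat and u v
  proof -
    have "(\<Sum>i<N. norm (f (v i) - f (u i))) \<le> (\<Sum>i<N. (L + 1) * (v i - u i))"
    proof (rule sum_mono)
      fix i assume "i \<in> {..<N}"
      then have i: "a \<le> u i" "u i \<le> v i" "v i \<le> b" using that by auto
      have "norm (f (v i) - f (u i)) \<le> L * norm (v i - u i)"
        using lipschitz_on_normD[OF assms, of "v i" "u i"] i by auto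
      also have "\<dots> \<le> (L + 1) * (v i - u i)" using i by (auto intro: mult_right_mono)
      finally show "norm (f (v i) - f (u i)) \<le> (L + 1) * (v i - u i)" .
    qed
    also have "\<dots> = (L + 1) * (\<Sum>i<N. v i - u i)" by (simp add: sum_distrib_left)
    also have "\<dots> < e" using that(2) L by (simp add: field_simps)
    finally show ?thesis .
  qed
  moreover have "e / (L + 1) > 0" using e L by simp
  ultimately show "\<exists>d>0. \<forall>(N::nat) u v. (\<forall>i<N. a \<le> u i \<and> u i \<le> v i \<and> v i \<le> b) \<and>
        disjoint_family_on (\<lambda>i. {u i<..<v i}) {..<N} \<and> (\<Sum>i<N. v i - u i) < d \<longrightarrow>
        (\<Sum>i<N. norm (f (v i) - f (u i))) < e"
    by (intro exI[of _ "e / (L + 1)"]) simp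
qed

text \<open>The finite set \<open>S\<close> is meant for the joints of a glued curve, where a
  straddling quotient mixes two pieces. It is a null set, and a Lipschitz curve has a derivative at
  almost every other time.\<close>

lemma solutionI:
  assumes F: "standard_map F" and lip: "\<And>T. \<exists>L. L-lipschitz_on {-T..T} z"
    and S: "finite S" and q: "\<And>t. t \<notin> S \<Longrightarrow> quotients_approach F z t"
  shows "solution F z"
  unfolding solution_def
proof (intro conjI allI)
  fix a b
  obtain L where L: "L-lipschitz_on {-(max \<bar>a\<bar> \<bar>b\<bar>)..max \<bar>a\<bar> \<bar>b\<bar>} z" using lip by blast
  show "abs_cont_on_interval a b z"
    by (rule lipschitz_abs_cont_on_interval, rule lipschitz_on_subset[OF L]) auto
next
  have "AE t in lborel. t \<notin> S"
    using S by (intro AE_not_in finite_imp_null_set_lborel)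
  then show "AE t in lborel. \<exists>v\<in>F (z t). (z has_vector_derivative v) (at t)"
    using locally_lipschitz_AE_differentiable[OF lip]
  proof eventually_elim
    case (elim t)
    then have "(z has_vector_derivative vector_derivative z (at t)) (at t)"
      by (simp add: vector_derivative_works)
    then show ?case using derivative_in_if_quotients_approach[OF F q[OF elim(1)]] by blast
  qed
qed

section \<open>Limits of approximate solutions\<close>

text \<open>A perturbed differential inclusion without derivatives or integrals: a convex set which contains
  all nearby values of the enlarged map contains, up to an error \<open>e\<close>, every mean velocity.\<close>

definition almost_inclusion :: "(real^'m \<Rightarrow> (real^'m) set) \<Rightarrow> real \<Rightarrow> real \<Rightarrow> (real \<Rightarrow> real^'m) \<Rightarrow> bool" where
  "almost_inclusion F e T Y \<longleftrightarrow> (\<forall>s s' C. 0 \<le> s \<and> s < s' \<and> s' \<le> T \<and> convex C \<and>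
     (\<forall>t. 0 \<le> t \<and> s - e \<le> t \<and> t \<le> s' \<longrightarrow> enlarge F e (Y t) \<subseteq> C) \<longrightarrow>
     (\<exists>v\<in>C. norm (Y s' - Y s - (s' - s) *\<^sub>R v) \<le> e))"

lemma enlarge_mono:
  assumes "d \<le> e"
  shows "enlarge F d x \<subseteq> enlarge F e x"
proof
  fix y assume "y \<in> enlarge F d x"
  then obtain z where "dist x z < d" "infdist y (F z) < d"
    unfolding enlarge_def by auto
  with assms have "dist x z < e" "infdist y (F z) < e" by auto
  then show "y \<in> enlarge F e x" unfolding enlarge_def by auto
qed

text \<open>The denominator uses \<open>L + 1\<close> so that it is positive for
  \<open>L = 0\<close> as well.\<close>

lemma mult_le_quarter:
  fixes L d r :: real
  assumes "0 \<le> L" "0 \<le> d" "d \<le> r / (4 * (L + 1))"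
  shows "L * d \<le> r / 4"
proof -
  have "d * (4 * (L + 1)) \<le> r" using assms by (simp add: pos_le_divide_eq)
  then show ?thesis using assms(2) by (simp add: algebra_simps)
qed

text \<open>By semicontinuity the enlarged map along the curves near \<open>t\<close> stays in the
  convex set \<open>?C\<close>, so \<open>almost_inclusion\<close> places the mean velocities there
  up to \<open>e' / (s' - s)\<close>. The endpoints stay fixed while \<open>j\<close> tends to
  infinity, and only afterwards is \<open>e'\<close> sent to 0.\<close>

lemma quotients_approach_limit:
  assumes F: "standard_map F" and t: "0 < t" "t < T"
    and lim: "\<And>t. 0 \<le> t \<Longrightarrow> (\<lambda>j. Y j t) \<longlonglongrightarrow> z t"
    and lip: "\<And>j. L-lipschitz_on {0..T} (Y j)"
    and inc: "\<And>e. e > 0 \<Longrightarrow> \<forall>\<^sub>F j in sequentially. almost_inclusion F e T (Y j)"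
  shows "quotients_approach F z t"
  unfolding quotients_approach_def
proof (intro allI impI)
  fix e :: real assume e: "e > 0"
  obtain r where r: "r > 0" "\<And>y. dist y (z t) < r \<Longrightarrow> enlarge F r y \<subseteq> {v. infdist v (F (z t)) \<le> e}"
    using standard_map_usc[OF F e] by blast
  let ?C = "{v. infdist v (F (z t)) \<le> e}"
  have L: "L \<ge> 0" using lip lipschitz_on_nonneg by blast
  \<comment> \<open>The test condition looks at times within \<open>2 * d\<close> of
    \<open>t\<close>, since \<open>e'\<close> will be at most \<open>d\<close>. Over this span a
    curve moves by at most \<open>r / 2\<close>; the other \<open>r / 2\<close> bounds the distance
    from \<open>Y j t\<close> to \<open>z t\<close>.\<close>
  define d where "d = min (min t (T - t)) (r / (4 * (L + 1)))"
  have d: "d > 0" "d \<le> t" "d \<le> T - t" "d \<le> r / (4 * (L + 1))"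
    using t r L by (auto simp: d_def)
  have Ld: "L * d \<le> r / 4" using L d by (intro mult_le_quarter) auto
  have "infdist ((z s' - z s) /\<^sub>R (s' - s)) (F (z t)) \<le> e"
    if s: "t - d < s" "s \<le> t" "t \<le> s'" "s' < t + d" "s < s'" for s s'
  proof -
    have *: "infdist ((z s' - z s) /\<^sub>R (s' - s)) (F (z t)) \<le> e + e' / (s' - s)"
      if e': "0 < e'" "e' \<le> d" "e' \<le> r" for e'
    proof -
      have "\<forall>\<^sub>F j in sequentially. dist (Y j t) (z t) < r / 2"
        using lim[of t] t r by (intro tendstoD) auto
      with inc[OF e'(1)] have "\<forall>\<^sub>F j in sequentially.
          infdist ((Y j s' - Y j s) /\<^sub>R (s' - s)) (F (z t)) \<le> e + e' / (s' - s)"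
      proof eventually_elim
        case (elim j)
        have "enlarge F e' (Y j t') \<subseteq> ?C" if t': "0 \<le> t'" "s - e' \<le> t'" "t' \<le> s'" for t'
        proof -
          have "dist (Y j t') (Y j t) \<le> L * dist t' t"
            using t' s d t by (intro lipschitz_onD[OF lip]) auto
          also have "\<dots> \<le> L * (2 * d)"
            using L t' s e' by (intro mult_left_mono) (auto simp: dist_real_def)
          also have "\<dots> \<le> r / 2" using Ld by simp
          finally have "dist (Y j t') (z t) < r"
            using elim(2) dist_triangle[of "Y j t'" "z t" "Y j t"] by linarith
          then show ?thesis using r(2) enlarge_mono[OF e'(3)] by blast
        qed
        moreover have "0 \<le> s" "s' \<le> T" using s d by auto
        ultimately obtain v where v: "v \<in> ?C" "norm (Y j s' - Y j s - (s' - s) *\<^sub>R v) \<le> e'"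
          using elim(1) s(5) convex_infdist_le[of "F (z t)" e] standard_map_values[OF F, of "z t"]
          unfolding almost_inclusion_def by meson
        have "(Y j s' - Y j s) /\<^sub>R (s' - s) - v = (Y j s' - Y j s - (s' - s) *\<^sub>R v) /\<^sub>R (s' - s)"
          using s by (simp add: scaleR_diff_right)
        then have "dist ((Y j s' - Y j s) /\<^sub>R (s' - s)) v \<le> e' / (s' - s)"
          using v(2) s by (simp add: dist_norm divide_inverse mult.commute mult_left_mono)
        then show ?case
          using v(1) infdist_triangle[of "(Y j s' - Y j s) /\<^sub>R (s' - s)" "F (z t)" v] by simp
      qed
      moreover have "(\<lambda>j. infdist ((Y j s' - Y j s) /\<^sub>R (s' - s)) (F (z t))) \<longlonglongrightarrow>
          infdist ((z s' - z s) /\<^sub>R (s' - s)) (F (z t))"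
        using s d by (intro tendsto_intros lim) auto
      ultimately show ?thesis by (intro tendsto_upperbound[OF _ _ sequentially_bot])
    qed
    show ?thesis
    proof (rule field_le_epsilon)
      fix q :: real assume q: "0 < q"
      define e' where "e' = min (min d r) (q * (s' - s))"
      have "0 < e'" "e' \<le> d" "e' \<le> r" "e' / (s' - s) \<le> q"
        using d r q s by (auto simp: e'_def divide_le_eq)
      then show "infdist ((z s' - z s) /\<^sub>R (s' - s)) (F (z t)) \<le> e + q"
        using *[of e'] by linarith
    qed
  qed
  then show "\<exists>d>0. \<forall>s s'. t - d < s \<and> s \<le> t \<and> t \<le> s' \<and> s' < t + d \<and> s < s' \<longrightarrow>
     infdist ((z s' - z s) /\<^sub>R (s' - s)) (F (z t)) \<le> e"
    using d(1) by (intro exI[of _ d]) auto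
qed

section \<open>Compactness for Lipschitz curves on the half line\<close>

lemma lipschitz_on_limit:
  assumes lim: "\<And>t. t \<in> S \<Longrightarrow> (\<lambda>j::nat. Y j t) \<longlonglongrightarrow> z t"
    and lip: "\<And>j. L-lipschitz_on S (Y j)"
  shows "L-lipschitz_on S z"
proof (rule lipschitz_onI)
  fix x y assume xy: "x \<in> S" "y \<in> S"
  have "(\<lambda>j. dist (Y j x) (Y j y)) \<longlonglongrightarrow> dist (z x) (z y)"
    using lim xy by (intro tendsto_dist)
  then show "dist (z x) (z y) \<le> L * dist x y"
    by (rule tendsto_upperbound)
      (use lipschitz_onD[OF lip] xy in \<open>auto intro!: always_eventually\<close>)
qed (use lip lipschitz_on_nonneg in blast)

text \<open>An Arzela-Ascoli argument with Lipschitz constants that may grow with the horizon: a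
  diagonal subsequence converges at the nonnegative rationals, and equicontinuity extends this to
  all times.\<close>

lemma lipschitz_convergent_subsequence:
  fixes Y :: "nat \<Rightarrow> real \<Rightarrow> 'a::euclidean_space"
  assumes lip: "\<And>T. T \<ge> 0 \<Longrightarrow> \<exists>L. \<forall>j. L-lipschitz_on {0..T} (Y j)"
    and bdd: "bounded (range (\<lambda>j. Y j 0))"
  obtains k z where "strict_mono (k::nat \<Rightarrow> nat)" "\<And>t. 0 \<le> t \<Longrightarrow> (\<lambda>j. Y (k j) t) \<longlonglongrightarrow> z t"
proof -
  have "\<exists>B>0. \<forall>j. norm (Y j t) \<le> B" if t: "0 \<le> t" for t
  proof -
    obtain B where B: "B > 0" "\<And>j. norm (Y j 0) \<le> B" using bdd unfolding bounded_pos by auto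
    obtain L where L: "\<And>j. L-lipschitz_on {0..t} (Y j)" using lip[OF t] by blast
    have "norm (Y j t) \<le> B + L * t" for j
      using lipschitz_onD[OF L, of t 0 j] t B(2)[of j] norm_triangle_sub[of "Y j t" "Y j 0"]
      by (simp add: dist_norm)
    moreover have "B + L * t > 0" using B(1) lipschitz_on_nonneg[OF L] t by (simp add: add_pos_nonneg)
    ultimately show ?thesis by blast
  qed
  then obtain B where B: "\<And>t. 0 \<le> t \<Longrightarrow> B t > 0" "\<And>t j. 0 \<le> t \<Longrightarrow> norm (Y j t) \<le> B t"
    by metis
  have "countable (\<rat> \<inter> {0::real..})" by (intro countable_subset[OF _ countable_rat]) auto
  \<comment> \<open>The diagonal theorem asks for one bound at all times; division by
    \<open>B t\<close> normalises it to 1.\<close>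
  moreover have "norm (Y j t /\<^sub>R B t) \<le> 1" if "t \<in> \<rat> \<inter> {0..}" for j t
  proof -
    have "norm (Y j t /\<^sub>R B t) = norm (Y j t) / B t" using B(1)[of t] that by (simp add: divide_inverse mult.commute)
    then show ?thesis using B[of t] that by simp
  qed
  ultimately obtain k where k: "strict_mono (k::nat \<Rightarrow> nat)"
      "\<And>t. t \<in> \<rat> \<inter> {0..} \<Longrightarrow> \<exists>l. (\<lambda>n. Y (k n) t /\<^sub>R B t) \<longlonglongrightarrow> l"
    using function_convergent_subsequence[of "\<rat> \<inter> {0::real..}" "\<lambda>j t. Y j t /\<^sub>R B t" 1] by blast
  have cau: "Cauchy (\<lambda>n. Y (k n) q)" if q: "q \<in> \<rat>" "0 \<le> q" for q
  proof -
    obtain l where "(\<lambda>n. Y (k n) q /\<^sub>R B q) \<longlonglongrightarrow> l" using k(2) q by blast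
    then have "(\<lambda>n. B q *\<^sub>R (Y (k n) q /\<^sub>R B q)) \<longlonglongrightarrow> B q *\<^sub>R l" by (intro tendsto_intros)
    then show ?thesis using B(1)[OF q(2)] by (intro LIMSEQ_imp_Cauchy) simp
  qed
  have "convergent (\<lambda>n. Y (k n) t)" if t: "0 \<le> t" for t
  proof (rule Cauchy_convergent, rule metric_CauchyI)
    fix e :: real assume e: "e > 0"
    obtain L where L: "\<And>j. L-lipschitz_on {0..t + 1} (Y j)" using lip[of "t + 1"] t by auto
    have L0: "L \<ge> 0" using L lipschitz_on_nonneg by blast
    define d where "d = min 1 (e / (4 * (L + 1)))"
    have d: "d > 0" "d \<le> 1" using e L0 by (auto simp: d_def)
    have Ld: "L * d \<le> e / 4" using L0 d by (intro mult_le_quarter) (auto simp: d_def)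
    \<comment> \<open>The rational lies to the right of \<open>t\<close> and at distance below 1,
      hence inside \<open>{0..t + 1}\<close>, where \<open>L\<close> is valid.\<close>
    obtain q where q: "q \<in> \<rat>" "t < q" "q < t + d" using Rats_dense_in_real[of t "t + d"] d by auto
    obtain N where N: "\<And>m n. m \<ge> N \<Longrightarrow> n \<ge> N \<Longrightarrow> dist (Y (k m) q) (Y (k n) q) < e / 2"
      using metric_CauchyD[OF cau[of q], of "e/2"] q t e by auto
    have near: "dist (Y (k m) t) (Y (k m) q) \<le> e / 4" for m
    proof -
      have "dist (Y (k m) t) (Y (k m) q) \<le> L * dist t q"
        using q d t by (intro lipschitz_onD[OF L]) auto
      also have "\<dots> \<le> L * d" using q L0 by (intro mult_left_mono) (auto simp: dist_real_def)
      finally show ?thesis using Ld by simp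
    qed
    have "dist (Y (k m) t) (Y (k n) t) < e" if "m \<ge> N" "n \<ge> N" for m n
    proof -
      have "dist (Y (k m) q) (Y (k n) t) \<le> dist (Y (k m) q) (Y (k n) q) + dist (Y (k n) t) (Y (k n) q)"
        by (rule dist_triangle2)
      moreover have "dist (Y (k m) t) (Y (k n) t) \<le> dist (Y (k m) t) (Y (k m) q) + dist (Y (k m) q) (Y (k n) t)"
        by (rule dist_triangle)
      ultimately show ?thesis using N[OF that] near[of n] near[of m] by linarith
    qed
    then show "\<exists>N. \<forall>m\<ge>N. \<forall>n\<ge>N. dist (Y (k m) t) (Y (k n) t) < e" by blast
  qed
  then show thesis
    using that[OF k(1), of "\<lambda>t. lim (\<lambda>n. Y (k n) t)"] by (simp add: convergent_LIMSEQ_iff)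
qed

section \<open>Locality, translation and reversal of the quotient condition\<close>

lemma quotients_approach_cong:
  assumes "quotients_approach F z t" "open S" "t \<in> S" "\<And>s. s \<in> S \<Longrightarrow> y s = z s"
  shows "quotients_approach F y t"
  unfolding quotients_approach_def
proof (intro allI impI)
  fix e :: real assume "e > 0"
  then obtain d where d: "d > 0" "\<And>s s'. t - d < s \<Longrightarrow> s \<le> t \<Longrightarrow> t \<le> s' \<Longrightarrow> s' < t + d \<Longrightarrow> s < s' \<Longrightarrow>
     infdist ((z s' - z s) /\<^sub>R (s' - s)) (F (z t)) \<le> e"
    using assms(1) unfolding quotients_approach_def by meson
  obtain d' where d': "d' > 0" "ball t d' \<subseteq> S" using assms(2,3) openE by blast
  have S: "y s = z s" if "t - d' < s" "s < t + d'" for s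
    using d'(2) assms(4) that by (auto simp: subset_eq dist_real_def)
  show "\<exists>d>0. \<forall>s s'. t - d < s \<and> s \<le> t \<and> t \<le> s' \<and> s' < t + d \<and> s < s' \<longrightarrow>
     infdist ((y s' - y s) /\<^sub>R (s' - s)) (F (y t)) \<le> e"
    using d d' S assms(3,4) by (intro exI[of _ "min d d'"]) auto
qed

lemma quotients_approach_shift:
  assumes "quotients_approach F z (t - c)"
  shows "quotients_approach F (\<lambda>t. z (t - c)) t"
  unfolding quotients_approach_def
proof (intro allI impI)
  fix e :: real assume "e > 0"
  then obtain d where d: "d > 0" "\<And>s s'. t - c - d < s \<Longrightarrow> s \<le> t - c \<Longrightarrow> t - c \<le> s' \<Longrightarrow> s' < t - c + d \<Longrightarrow> s < s' \<Longrightarrow>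
     infdist ((z s' - z s) /\<^sub>R (s' - s)) (F (z (t - c))) \<le> e"
    using assms(1) unfolding quotients_approach_def by meson
  show "\<exists>d>0. \<forall>s s'. t - d < s \<and> s \<le> t \<and> t \<le> s' \<and> s' < t + d \<and> s < s' \<longrightarrow>
     infdist ((z (s' - c) - z (s - c)) /\<^sub>R (s' - s)) (F (z (t - c))) \<le> e"
    using d(1) d(2)[of "s - c" "s' - c" for s s'] by (intro exI[of _ d]) auto
qed

lemma infdist_uminus: "infdist (- x) (uminus ` S) = infdist x (S :: 'a::real_normed_vector set)"
proof -
  have "(\<lambda>a. dist (- x) a) ` uminus ` S = (\<lambda>a. dist x a) ` S"
    unfolding image_image dist_minus ..
  then show ?thesis unfolding infdist_def by simp
qed

text \<open>The condition treats both sides of \<open>t\<close> alike, so time reversal permutes the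
  intervals concerned and only changes the sign of the quotients.\<close>

lemma quotients_approach_reverse:
  assumes "quotients_approach (\<lambda>x. uminus ` F x) z (- t)"
  shows "quotients_approach F (\<lambda>t. z (- t)) t"
  unfolding quotients_approach_def
proof (intro allI impI)
  fix e :: real assume "e > 0"
  then obtain d where d: "d > 0" "\<And>s s'. - t - d < s \<Longrightarrow> s \<le> - t \<Longrightarrow> - t \<le> s' \<Longrightarrow> s' < - t + d \<Longrightarrow> s < s' \<Longrightarrow>
     infdist ((z s' - z s) /\<^sub>R (s' - s)) (uminus ` F (z (- t))) \<le> e"
    using assms(1) unfolding quotients_approach_def by meson
  have "infdist ((z (- s') - z (- s)) /\<^sub>R (s' - s)) (F (z (- t))) \<le> e"
    if "t - d < s" "s \<le> t" "t \<le> s'" "s' < t + d" "s < s'" for s s'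
  proof -
    have "(z (- s) - z (- s')) /\<^sub>R (- s - - s') = - ((z (- s') - z (- s)) /\<^sub>R (s' - s))"
      by (simp add: scaleR_diff_right)
    then have "infdist (- ((z (- s') - z (- s)) /\<^sub>R (s' - s))) (uminus ` F (z (- t))) \<le> e"
      using d(2)[of "- s'" "- s"] that by simp
    then show ?thesis unfolding infdist_uminus .
  qed
  then show "\<exists>d>0. \<forall>s s'. t - d < s \<and> s \<le> t \<and> t \<le> s' \<and> s' < t + d \<and> s < s' \<longrightarrow>
     infdist ((z (- s') - z (- s)) /\<^sub>R (s' - s)) (F (z (- t))) \<le> e"
    using d(1) by (intro exI[of _ d]) auto
qed

text \<open>The quotient condition is two-sided, hence imposed only for \<open>t > 0\<close>: at 0
  it would involve values of \<open>z\<close> at negative times.\<close>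

definition forward_solution :: "(real^'m \<Rightarrow> (real^'m) set) \<Rightarrow> (real \<Rightarrow> real^'m) \<Rightarrow> bool" where
  "forward_solution F z \<longleftrightarrow> (\<forall>T. \<exists>L. L-lipschitz_on {0..T} z) \<and> (\<forall>t>0. quotients_approach F z t)"

text \<open>\<open>flow\<close> quantifies over solutions on the whole line, so a curve known on
  \<open>{0..T}\<close> has to be completed: \<open>y\<close>, run backwards, supplies the past and
  \<open>w\<close> the future. The quotient condition may fail at 0 and \<open>T\<close>, which
  \<open>solutionI\<close> permits.\<close>

lemma solution_glue:
  assumes F: "standard_map F" and T: "0 \<le> T"
    and lip: "L-lipschitz_on {0..T} z" and q: "\<And>t. 0 < t \<Longrightarrow> t < T \<Longrightarrow> quotients_approach F z t"
    and b: "forward_solution (\<lambda>x. uminus ` F x) y" "y 0 = z 0"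
    and f: "forward_solution F w" "w 0 = z T"
  obtains x where "x \<in> solutions_from F (z 0)" "\<And>t. t \<in> {0..T} \<Longrightarrow> x t = z t"
proof -
  define x where "x t = (if t \<le> 0 then y (- t) else if t \<le> T then z t else w (t - T))" for t
  have xz: "x t = z t" if "t \<in> {0..T}" for t using that b(2) by (cases "t = 0") (auto simp: x_def)
  have xw: "x t = w (t - T)" if "t \<ge> T" for t
    using that f(2) b(2) T by (cases "t = T"; cases "t = 0") (auto simp: x_def)
  have "solution F x"
  proof (rule solutionI[OF F, of _ "{0, T}"])
    fix R :: real
    obtain L1 where L1: "L1-lipschitz_on {0..\<bar>R\<bar>} y" using b unfolding forward_solution_def by blast
    obtain L2 where L2: "L2-lipschitz_on {0..\<bar>R\<bar>} w" using f unfolding forward_solution_def by blast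
    \<comment> \<open>Concatenation of Lipschitz pieces asks for the same constant on each of
      them.\<close>
    let ?L = "max L (max L1 L2)"
    have "?L-lipschitz_on {-\<bar>R\<bar>..0} x"
    proof (rule lipschitz_onI)
      fix s t assume "s \<in> {-\<bar>R\<bar>..0}" "t \<in> {-\<bar>R\<bar>..0}"
      then have "dist (x s) (x t) \<le> L1 * dist (-s) (-t)"
        unfolding x_def using lipschitz_onD[OF L1, of "-s" "-t"] by auto
      also have "\<dots> \<le> ?L * dist s t" by (auto simp: dist_minus intro!: mult_right_mono)
      finally show "dist (x s) (x t) \<le> ?L * dist s t" .
    qed (use lipschitz_on_nonneg[OF lip] in auto)
    moreover have "?L-lipschitz_on {0..T} x"
      using xz by (intro lipschitz_on_transform[OF lipschitz_on_mono[OF lip, of "{0..T}" ?L]]) auto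
    \<comment> \<open>The concatenation lemma yields a case distinction; with \<open>x\<close> in
      both branches it collapses.\<close>
    ultimately have "?L-lipschitz_on {-\<bar>R\<bar>..T} (\<lambda>t. if t \<le> 0 then x t else x t)"
      by (rule lipschitz_on_concat) simp
    then have 1: "?L-lipschitz_on {-\<bar>R\<bar>..T} x" by simp
    have "?L-lipschitz_on {T..T + \<bar>R\<bar>} x"
    proof (rule lipschitz_onI)
      fix s t assume "s \<in> {T..T + \<bar>R\<bar>}" "t \<in> {T..T + \<bar>R\<bar>}"
      then have "dist (x s) (x t) \<le> L2 * dist (s - T) (t - T)"
        using lipschitz_onD[OF L2, of "s - T" "t - T"] xw by auto
      also have "\<dots> \<le> ?L * dist s t" by (auto simp: dist_real_def intro!: mult_right_mono)
      finally show "dist (x s) (x t) \<le> ?L * dist s t" .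
    qed (use lipschitz_on_nonneg[OF lip] in auto)
    with 1 have "?L-lipschitz_on {-\<bar>R\<bar>..T + \<bar>R\<bar>} (\<lambda>t. if t \<le> T then x t else x t)"
      by (rule lipschitz_on_concat) simp
    then have "?L-lipschitz_on {-\<bar>R\<bar>..T + \<bar>R\<bar>} x" by simp
    then have "?L-lipschitz_on {-R..R} x" using T by (elim lipschitz_on_subset) auto
    then show "\<exists>L. L-lipschitz_on {-R..R} x" by blast
  next
    fix t :: real assume "t \<notin> {0, T}"
    then consider "t < 0" | "0 < t" "t < T" | "t > T" by force
    then show "quotients_approach F x t"
    proof cases
      case 1
      then have "quotients_approach F (\<lambda>t. y (- t)) t"
        using b(1) by (intro quotients_approach_reverse) (simp add: forward_solution_def)
      then show ?thesis
        by (rule quotients_approach_cong[where S = "{..<0}"]) (use 1 in \<open>auto simp: x_def\<close>)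
    next
      case 2
      show ?thesis
        by (rule quotients_approach_cong[OF q[OF 2], where S = "{0<..<T}"]) (use 2 xz in auto)
    next
      case 3
      then have "quotients_approach F (\<lambda>t. w (t - T)) t"
        using f(1) by (intro quotients_approach_shift) (simp add: forward_solution_def)
      then show ?thesis
        by (rule quotients_approach_cong[where S = "{T<..}"]) (use 3 xw in auto)
    qed
  qed auto
  moreover have "x 0 = z 0" using xz[of 0] T by simp
  ultimately show thesis using that[of x] xz by (auto simp: solutions_from_def)
qed

section \<open>Interpolated discrete schemes\<close>

lemma step_time_0 [simp]: "step_time \<gamma> 0 = 0"
  by (simp add: step_time_def)

lemma step_time_strict_mono:
  assumes "\<And>n. \<gamma> n > 0" shows "strict_mono (step_time \<gamma>)"
  using assms by (simp add: strict_mono_Suc_iff step_time_Suc)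

lemma step_time_diff:
  assumes "a \<le> b" shows "step_time \<gamma> b - step_time \<gamma> a = (\<Sum>i=a..<b. \<gamma> (Suc i))"
  using sum_Suc_diff'[OF assms, of "step_time \<gamma>"] by (simp add: step_time_Suc)

text \<open>The divergence hypothesis sums from index 0, while \<open>step_time\<close> starts at 1;
  the two differ by the constant \<open>\<gamma> 0\<close> and a shift of the index.\<close>

lemma filterlim_step_time:
  assumes "filterlim (\<lambda>n. \<Sum>i<n. \<gamma> i) at_top sequentially"
  shows "filterlim (step_time \<gamma>) at_top sequentially"
proof -
  have "filterlim (\<lambda>n. \<Sum>i<Suc n. \<gamma> i) at_top sequentially"
    using assms by (rule filterlim_compose[OF _ filterlim_Suc])
  then have "filterlim (\<lambda>n. - \<gamma> 0 + (\<Sum>i<Suc n. \<gamma> i)) at_top sequentially"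
    by (rule filterlim_tendsto_add_at_top[OF tendsto_const])
  moreover have "- \<gamma> 0 + (\<Sum>i<Suc n. \<gamma> i) = step_time \<gamma> n" for n
    by (simp only: sum.lessThan_Suc_shift step_time_def) (simp add: sum.atLeast1_atMost_eq)
  ultimately show ?thesis by simp
qed

lemma step_time_bracket:
  assumes "filterlim (step_time \<gamma>) at_top sequentially" and "0 \<le> t"
  obtains i where "step_time \<gamma> i \<le> t" "t < step_time \<gamma> (Suc i)"
proof -
  have "\<exists>n. t < step_time \<gamma> n"
    using assms(1) unfolding filterlim_at_top_dense eventually_sequentially by blast
  then have n: "t < step_time \<gamma> (LEAST n. t < step_time \<gamma> n)" by (rule LeastI_ex)
  then obtain i where i: "(LEAST n. t < step_time \<gamma> n) = Suc i"
    using assms(2) by (cases "LEAST n. t < step_time \<gamma> n") auto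
  then have "\<not> t < step_time \<gamma> i" using not_less_Least[of i "\<lambda>n. t < step_time \<gamma> n"] by simp
  then show thesis using that[of i] n i by simp
qed

context
  fixes \<gamma> :: "nat \<Rightarrow> real" and x :: "nat \<Rightarrow> 'w \<Rightarrow> real^'m" and \<omega> :: 'w
  assumes pos: "\<And>n. \<gamma> n > 0"
begin

lemma interpolated_segment:
  assumes "step_time \<gamma> i \<le> t" "t \<le> step_time \<gamma> (Suc i)"
  shows "interpolated \<gamma> x \<omega> t = x i \<omega> + ((t - step_time \<gamma> i) / \<gamma> (Suc i)) *\<^sub>R (x (Suc i) \<omega> - x i \<omega>)"
  using interpolated_step_time_add[of \<gamma> "t - step_time \<gamma> i" i x \<omega>] pos assms by (simp add: step_time_Suc)

lemma interpolated_step_time [simp]: "interpolated \<gamma> x \<omega> (step_time \<gamma> i) = x i \<omega>"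
  using interpolated_segment[of i "step_time \<gamma> i"] pos[of "Suc i"] by (simp add: step_time_Suc)

lemma norm_interpolated_diff_le:
  assumes "step_time \<gamma> i \<le> t" "t \<le> step_time \<gamma> (Suc i)"
  shows "norm (interpolated \<gamma> x \<omega> t - x i \<omega>) \<le> norm (x (Suc i) \<omega> - x i \<omega>)"
proof -
  have "\<bar>(t - step_time \<gamma> i) / \<gamma> (Suc i)\<bar> \<le> 1"
    using assms pos[of "Suc i"] by (simp add: step_time_Suc)
  then have "\<bar>(t - step_time \<gamma> i) / \<gamma> (Suc i)\<bar> * norm (x (Suc i) \<omega> - x i \<omega>) \<le> 1 * norm (x (Suc i) \<omega> - x i \<omega>)"
    by (rule mult_right_mono) simp
  then show ?thesis unfolding interpolated_segment[OF assms] by simp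
qed

lemma lipschitz_on_interpolated_segment:
  assumes "norm (x (Suc i) \<omega> - x i \<omega>) \<le> L * \<gamma> (Suc i)"
  shows "L-lipschitz_on {step_time \<gamma> i..step_time \<gamma> (Suc i)} (interpolated \<gamma> x \<omega>)"
proof (rule lipschitz_onI)
  fix s t assume st: "s \<in> {step_time \<gamma> i..step_time \<gamma> (Suc i)}" "t \<in> {step_time \<gamma> i..step_time \<gamma> (Suc i)}"
  have eq: "(s - t) / \<gamma> (Suc i) = (s - step_time \<gamma> i) / \<gamma> (Suc i) - (t - step_time \<gamma> i) / \<gamma> (Suc i)"
    by (simp add: diff_divide_distrib)
  have "interpolated \<gamma> x \<omega> s - interpolated \<gamma> x \<omega> t = ((s - t) / \<gamma> (Suc i)) *\<^sub>R (x (Suc i) \<omega> - x i \<omega>)"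
    unfolding eq scaleR_diff_left using st interpolated_segment[of i s] interpolated_segment[of i t] by simp
  then have "dist (interpolated \<gamma> x \<omega> s) (interpolated \<gamma> x \<omega> t) = \<bar>s - t\<bar> / \<gamma> (Suc i) * norm (x (Suc i) \<omega> - x i \<omega>)"
    using pos[of "Suc i"] by (simp add: dist_norm abs_divide)
  also have "\<dots> \<le> \<bar>s - t\<bar> / \<gamma> (Suc i) * (L * \<gamma> (Suc i))"
    using pos[of "Suc i"] assms by (intro mult_left_mono) auto
  finally show "dist (interpolated \<gamma> x \<omega> s) (interpolated \<gamma> x \<omega> t) \<le> L * dist s t"
    using pos[of "Suc i"] by (simp add: dist_real_def mult.commute)
next
  show "0 \<le> L" using assms pos[of "Suc i"] by (smt (verit) norm_ge_zero mult_neg_pos)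
qed

text \<open>The segments are joined up to index \<open>Suc b\<close>, where segment \<open>b\<close>
  contains the end of the horizon; all of them start within the horizon, where increments are
  controlled.\<close>

lemma lipschitz_on_interpolated:
  assumes lim: "filterlim (step_time \<gamma>) at_top sequentially" and T: "0 \<le> T" and L: "0 \<le> L"
    and inc: "\<And>i. n \<le> i \<Longrightarrow> step_time \<gamma> i \<le> step_time \<gamma> n + T \<Longrightarrow> norm (x (Suc i) \<omega> - x i \<omega>) \<le> L * \<gamma> (Suc i)"
  shows "L-lipschitz_on {0..T} (\<lambda>t. interpolated \<gamma> x \<omega> (step_time \<gamma> n + t))"
proof -
  have mono: "mono (step_time \<gamma>)" using step_time_strict_mono[of \<gamma>, OF pos] by (rule strict_mono_mono)
  have "0 \<le> step_time \<gamma> n + T" using monoD[OF mono, of 0 n] T by simp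
  then obtain b where b: "step_time \<gamma> b \<le> step_time \<gamma> n + T" "step_time \<gamma> n + T < step_time \<gamma> (Suc b)"
    using step_time_bracket[OF lim] by blast
  have nb: "n < Suc b"
    using b(2) T strict_mono_less[OF step_time_strict_mono[of \<gamma>, OF pos], of n "Suc b"] by simp
  have "L-lipschitz_on {step_time \<gamma> n..step_time \<gamma> m} (interpolated \<gamma> x \<omega>)" if "n \<le> m" "m \<le> Suc b" for m
    using that
  proof (induction m rule: dec_induct)
    case base
    then show ?case using L by (simp add: lipschitz_on_singleton)
  next
    case (step m)
    have "step_time \<gamma> m \<le> step_time \<gamma> n + T" using step b(1) monoD[OF mono, of m b] by simp
    then have "L-lipschitz_on {step_time \<gamma> m..step_time \<gamma> (Suc m)} (interpolated \<gamma> x \<omega>)"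
      using step by (intro lipschitz_on_interpolated_segment inc) auto
    with step have "L-lipschitz_on {step_time \<gamma> n..step_time \<gamma> (Suc m)}
      (\<lambda>t. if t \<le> step_time \<gamma> m then interpolated \<gamma> x \<omega> t else interpolated \<gamma> x \<omega> t)"
      by (intro lipschitz_on_concat) auto
    then show ?case by simp
  qed
  from this[of "Suc b"] have lipb: "L-lipschitz_on {step_time \<gamma> n..step_time \<gamma> (Suc b)} (interpolated \<gamma> x \<omega>)"
    using nb by simp
  show ?thesis
  proof (rule lipschitz_onI[OF _ L])
    fix s t assume "s \<in> {0..T}" "t \<in> {0..T}"
    then show "dist (interpolated \<gamma> x \<omega> (step_time \<gamma> n + s)) (interpolated \<gamma> x \<omega> (step_time \<gamma> n + t)) \<le> L * dist s t"
      using lipschitz_onD[OF lipb, of "step_time \<gamma> n + s" "step_time \<gamma> n + t"] b(2) by simp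
  qed
qed

text \<open>Between the indices \<open>a\<close> and \<open>b\<close> of the segments containing the
  two times, the velocities \<open>v i\<close>, weighted by step lengths, average to a point
  \<open>w\<close> of \<open>C\<close>. The errors are \<open>h * (R + K)\<close> for each
  incomplete end segment, \<open>h * R\<close> for the mismatch of durations and
  \<open>2 * d\<close> for the noise, which adds up to the bound required in
  \<open>small\<close>.\<close>

lemma almost_inclusion_interpolated:
  assumes lim: "filterlim (step_time \<gamma>) at_top sequentially"
    and rec: "\<And>i. n \<le> i \<Longrightarrow> step_time \<gamma> i \<le> step_time \<gamma> n + T \<Longrightarrow>
      x (Suc i) \<omega> - x i \<omega> = \<gamma> (Suc i) *\<^sub>R (v i + u i)"
    and v: "\<And>i. n \<le> i \<Longrightarrow> step_time \<gamma> i \<le> step_time \<gamma> n + T \<Longrightarrow> v i \<in> enlarge F e (x i \<omega>)"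
      "\<And>i. n \<le> i \<Longrightarrow> step_time \<gamma> i \<le> step_time \<gamma> n + T \<Longrightarrow> norm (v i) \<le> R"
    and u: "\<And>i. n \<le> i \<Longrightarrow> step_time \<gamma> i \<le> step_time \<gamma> n + T \<Longrightarrow> norm (u i) \<le> K"
    and h: "\<And>i. n \<le> i \<Longrightarrow> \<gamma> (Suc i) \<le> h"
    and noise: "\<And>k. n \<le> k \<Longrightarrow> step_time \<gamma> k \<le> step_time \<gamma> n + T \<Longrightarrow>
      norm (\<Sum>i=n..<k. \<gamma> (Suc i) *\<^sub>R u i) \<le> d"
    and small: "h \<le> e" "h * (3 * R + 2 * K) + 2 * d \<le> e"
  shows "almost_inclusion F e T (\<lambda>t. interpolated \<gamma> x \<omega> (step_time \<gamma> n + t))"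
  unfolding almost_inclusion_def
proof (intro allI impI, elim conjE)
  fix s s' C
  assume s: "0 \<le> s" "s < s'" "s' \<le> T" and C: "convex C"
    and enl: "\<forall>t. 0 \<le> t \<and> s - e \<le> t \<and> t \<le> s' \<longrightarrow>
      enlarge F e (interpolated \<gamma> x \<omega> (step_time \<gamma> n + t)) \<subseteq> C"
  let ?\<tau> = "step_time \<gamma>" and ?X = "interpolated \<gamma> x \<omega>"
  have sm: "strict_mono ?\<tau>" using step_time_strict_mono[of \<gamma>, OF pos] .
  have mono: "mono ?\<tau>" using sm by (rule strict_mono_mono)
  have n0: "0 \<le> ?\<tau> n" using monoD[OF mono, of 0 n] by simp
  obtain a where a: "?\<tau> a \<le> ?\<tau> n + s" "?\<tau> n + s < ?\<tau> (Suc a)"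
    using step_time_bracket[OF lim, of "?\<tau> n + s"] n0 s by auto
  obtain b where b: "?\<tau> b \<le> ?\<tau> n + s'" "?\<tau> n + s' < ?\<tau> (Suc b)"
    using step_time_bracket[OF lim, of "?\<tau> n + s'"] n0 s by auto
  have na: "n \<le> a" using a(2) s strict_mono_less[OF sm, of n "Suc a"] by simp
  have ab: "a \<le> b" using a(1) b(2) s strict_mono_less[OF sm, of a "Suc b"] by simp
  have idx: "n \<le> i" "?\<tau> i \<le> ?\<tau> n + T" if "a \<le> i" "i \<le> b" for i
    using that na monoD[OF mono, of i b] b(1) s by auto
  have h0: "0 \<le> h" using h[OF na] pos[of "Suc a"] by linarith
  have R0: "0 \<le> R" and K0: "0 \<le> K"
    using v(2)[of a] u[of a] idx[of a] ab norm_ge_zero order_trans by blast+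
  have stepn: "norm (x (Suc i) \<omega> - x i \<omega>) \<le> h * (R + K)" if "a \<le> i" "i \<le> b" for i
  proof -
    note i = idx[OF that]
    have "norm (x (Suc i) \<omega> - x i \<omega>) = \<gamma> (Suc i) * norm (v i + u i)"
      using rec[OF i] pos[of "Suc i"] by simp
    also have "\<dots> \<le> h * (R + K)"
      using h[OF i(1)] v(2)[OF i] u[OF i] norm_triangle_ineq[of "v i" "u i"] h0
      by (intro mult_mono) auto
    finally show ?thesis .
  qed
  have vC: "v i \<in> C" if "a \<le> i" "i \<le> b" for i
  proof -
    note i = idx[OF that]
    have "?\<tau> (Suc a) \<le> ?\<tau> a + h" using h[OF na] by (simp add: step_time_Suc)
    \<comment> \<open>Segment \<open>a\<close> may start before \<open>s\<close>, but by at most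
      \<open>h\<close>, hence by at most \<open>e\<close>. This is why the test condition reaches
      back to \<open>s - e\<close>.\<close>
    then have "s - e \<le> ?\<tau> i - ?\<tau> n" "?\<tau> i - ?\<tau> n \<le> s'" "0 \<le> ?\<tau> i - ?\<tau> n"
      using a(2) small(1) monoD[OF mono that(1)] monoD[OF mono that(2)] b(1) monoD[OF mono i(1)] by auto
    then have "enlarge F e (?X (?\<tau> n + (?\<tau> i - ?\<tau> n))) \<subseteq> C" using enl by blast
    then show ?thesis using v(1)[OF i] by auto
  qed
  \<comment> \<open>Averaging inside \<open>C \<inter> cball 0 R\<close> also preserves the norm
    bound, which the mismatch term uses. For \<open>a = b\<close> the sum is empty, and
    \<open>v a\<close> serves as a default.\<close>
  obtain w where w: "w \<in> C" "norm w \<le> R" "(\<Sum>i=a..<b. \<gamma> (Suc i) *\<^sub>R v i) = (?\<tau> b - ?\<tau> a) *\<^sub>R w"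
  proof (cases "a = b")
    case True
    then show thesis using that[of "v a"] vC[of a] v(2)[of a] idx[of a] by simp
  next
    case False
    then have ab': "?\<tau> b - ?\<tau> a > 0" using ab strict_monoD[OF sm, of a b] by simp
    let ?w = "\<Sum>i=a..<b. (\<gamma> (Suc i) / (?\<tau> b - ?\<tau> a)) *\<^sub>R v i"
    have "?w \<in> C \<inter> cball 0 R"
    proof (rule convex_sum)
      show "(\<Sum>i=a..<b. \<gamma> (Suc i) / (?\<tau> b - ?\<tau> a)) = 1"
        using ab' by (simp add: sum_divide_distrib[symmetric] step_time_diff[OF ab, symmetric])
      show "0 \<le> \<gamma> (Suc i) / (?\<tau> b - ?\<tau> a)" for i
        using ab' pos[of "Suc i"] by simp
      show "v i \<in> C \<inter> cball 0 R" if "i \<in> {a..<b}" for i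
        using that vC[of i] v(2)[of i] idx[of i] by simp
    qed (auto intro: convex_Int C)
    then have "?w \<in> C" "norm ?w \<le> R" by auto
    moreover have "(\<Sum>i=a..<b. \<gamma> (Suc i) *\<^sub>R v i) = (?\<tau> b - ?\<tau> a) *\<^sub>R ?w"
      using ab' by (simp add: scaleR_sum_right)
    ultimately show thesis by (rule that)
  qed
  have "x b \<omega> - x a \<omega> = (\<Sum>i=a..<b. x (Suc i) \<omega> - x i \<omega>)"
    using sum_Suc_diff'[OF ab, of "\<lambda>i. x i \<omega>"] by simp
  also have "\<dots> = (\<Sum>i=a..<b. \<gamma> (Suc i) *\<^sub>R v i + \<gamma> (Suc i) *\<^sub>R u i)"
    using rec idx by (intro sum.cong) (auto simp: scaleR_add_right)
  also have "\<dots> = (?\<tau> b - ?\<tau> a) *\<^sub>R w + (\<Sum>i=a..<b. \<gamma> (Suc i) *\<^sub>R u i)"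
    by (simp add: sum.distrib w(3))
  finally have xab: "x b \<omega> - x a \<omega> = (?\<tau> b - ?\<tau> a) *\<^sub>R w + (\<Sum>i=a..<b. \<gamma> (Suc i) *\<^sub>R u i)" .
  have "(\<Sum>i=a..<b. \<gamma> (Suc i) *\<^sub>R u i) = (\<Sum>i=n..<b. \<gamma> (Suc i) *\<^sub>R u i) - (\<Sum>i=n..<a. \<gamma> (Suc i) *\<^sub>R u i)"
    using sum.atLeastLessThan_concat[OF na ab, of "\<lambda>i. \<gamma> (Suc i) *\<^sub>R u i"] by (simp add: algebra_simps)
  then have N: "norm (\<Sum>i=a..<b. \<gamma> (Suc i) *\<^sub>R u i) \<le> 2 * d"
    using noise[OF idx[of a]] noise[OF idx[of b]] ab
      norm_triangle_ineq4[of "\<Sum>i=n..<b. \<gamma> (Suc i) *\<^sub>R u i" "\<Sum>i=n..<a. \<gamma> (Suc i) *\<^sub>R u i"] by simp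
  have Xa: "norm (?X (?\<tau> n + s) - x a \<omega>) \<le> h * (R + K)"
    using norm_interpolated_diff_le[of a "?\<tau> n + s"] a stepn[of a] ab by simp
  have Xb: "norm (?X (?\<tau> n + s') - x b \<omega>) \<le> h * (R + K)"
    using norm_interpolated_diff_le[of b "?\<tau> n + s'"] b stepn[of b] ab by simp
  \<comment> \<open>Both rounding errors, at \<open>a\<close> and at \<open>b\<close>, lie between 0
    and \<open>h\<close>, so their difference is at most \<open>h\<close> and not
    \<open>2 * h\<close>.\<close>
  have "\<bar>(?\<tau> b - ?\<tau> a) - (s' - s)\<bar> \<le> h"
    using a b h[of a] h[of b] na ab by (simp add: step_time_Suc)
  then have W: "norm (((?\<tau> b - ?\<tau> a) - (s' - s)) *\<^sub>R w) \<le> h * R"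
    using w(2) h0 by (simp add: mult_mono)
  have four: "norm (p - q + (y + z)) \<le> (norm p + norm q) + (norm y + norm z)" for p q y z :: "real^'m"
    by (rule order_trans[OF norm_triangle_ineq add_mono[OF norm_triangle_ineq4 norm_triangle_ineq]])
  have eq: "?X (?\<tau> n + s') - ?X (?\<tau> n + s) - (s' - s) *\<^sub>R w =
      (?X (?\<tau> n + s') - x b \<omega>) - (?X (?\<tau> n + s) - x a \<omega>) + (((?\<tau> b - ?\<tau> a) - (s' - s)) *\<^sub>R w
      + (\<Sum>i=a..<b. \<gamma> (Suc i) *\<^sub>R u i))"
    using xab by (simp add: algebra_simps)
  have "norm (?X (?\<tau> n + s') - ?X (?\<tau> n + s) - (s' - s) *\<^sub>R w) \<le> (h * (R + K) + h * (R + K)) + (h * R + 2 * d)"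
    unfolding eq by (rule order_trans[OF four add_mono[OF add_mono[OF Xb Xa] add_mono[OF W N]]])
  also have "\<dots> \<le> e" using small(2) by (simp add: algebra_simps)
  finally show "\<exists>v\<in>C. norm (?X (?\<tau> n + s') - ?X (?\<tau> n + s) - (s' - s) *\<^sub>R v) \<le> e"
    using w(1) by blast
qed

end

text \<open>An arbitrary, possibly discontinuous selection of \<open>F\<close> drives the polygons;
  semicontinuity and convexity repair this in the limit. The result provides both ends of a glued
  solution.\<close>

lemma forward_solution_exists:
  fixes F :: "real^'m \<Rightarrow> (real^'m) set"
  assumes F: "standard_map F"
  obtains z where "forward_solution F z" "z 0 = p"
proof -
  obtain c where c: "c > 0" "\<And>x z. z \<in> F x \<Longrightarrow> norm z \<le> c * (1 + norm x)"
    using standard_map_growth[OF F] by blast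
  \<comment> \<open>limits of Euler polygons\<close>
  define f where "f y = (SOME v. v \<in> F y)" for y
  have f: "f y \<in> F y" for y
    unfolding f_def using standard_map_values(1)[OF F] by (simp add: some_in_eq)
  define h where "h j = 1 / real (Suc j)" for j
  have h: "h j > 0" for j by (simp add: h_def)
  have h_lim: "h \<longlonglongrightarrow> 0"
    using LIMSEQ_inverse_real_of_nat by (simp add: h_def[abs_def] inverse_eq_divide)
  define y where "y j i = ((\<lambda>y. y + h j *\<^sub>R f y) ^^ i) p" for j i
  have ySuc: "y j (Suc i) = y j i + h j *\<^sub>R f (y j i)" and y0: "y j 0 = p" for i j
    by (simp_all add: y_def)
  \<comment> \<open>A polygon is an interpolated scheme with constant step on the one-point sample
    space \<open>unit\<close>, so the estimates for interpolated paths apply.\<close>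
  define Y where "Y j = interpolated (\<lambda>_. h j) (\<lambda>i (_::unit). y j i) ()" for j
  have tau: "step_time (\<lambda>_. h j) i = real i * h j" for i j
    by (simp add: step_time_def)
  have tau_lim: "filterlim (step_time (\<lambda>_. h j)) at_top sequentially" for j
    unfolding tau using filterlim_at_top_mult_tendsto_pos[OF tendsto_const h filterlim_real_sequentially] .
  \<comment> \<open>A discrete Gronwall bound: each step multiplies \<open>1 + norm (y j i)\<close>
    by at most \<open>1 + c * h j\<close>, hence by at most \<open>exp (c * h j)\<close>.\<close>
  define R where "R T = exp (c * T) * (1 + norm p)" for T
  have growth: "1 + norm (y j i) \<le> R (real i * h j)" for i j
  proof (induction i)
    case (Suc i)
    have "1 + norm (y j (Suc i)) \<le> (1 + norm (y j i)) + h j * norm (f (y j i))"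
      using norm_triangle_ineq[of "y j i" "h j *\<^sub>R f (y j i)"] h[of j] by (simp add: ySuc)
    also have "\<dots> \<le> (1 + norm (y j i)) + h j * (c * (1 + norm (y j i)))"
      using c(2)[OF f] h[of j] by (intro add_left_mono mult_left_mono) auto
    also have "\<dots> = (1 + c * h j) * (1 + norm (y j i))" by (simp add: algebra_simps)
    also have "\<dots> \<le> exp (c * h j) * R (real i * h j)"
      using Suc by (intro mult_mono exp_ge_add_one_self) auto
    also have "\<dots> = R (real (Suc i) * h j)"
      by (simp add: R_def algebra_simps flip: exp_add)
    finally show ?case .
  qed (simp add: y0 R_def)
  have R_mono: "R s \<le> R t" if "s \<le> t" for s t
    using that c(1) by (auto simp: R_def intro!: mult_right_mono)
  have bound: "norm (f (y j i)) \<le> c * R T" if "real i * h j \<le> T" for i j T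
    using c(2)[OF f, of "y j i"] growth[of j i] R_mono[OF that] c(1)
      mult_left_mono[of "1 + norm (y j i)" "R T" c] by linarith
  have R0: "0 \<le> R T" for T by (simp add: R_def)
  have lip: "(c * R T)-lipschitz_on {0..T} (Y j)" if T: "0 \<le> T" for T j
  proof -
    have "(c * R T)-lipschitz_on {0..T} (\<lambda>t. interpolated (\<lambda>_. h j) (\<lambda>i (_::unit). y j i) () (step_time (\<lambda>_. h j) 0 + t))"
    proof (rule lipschitz_on_interpolated[OF _ tau_lim T])
      show "norm (y j (Suc i) - y j i) \<le> c * R T * h j"
        if "step_time (\<lambda>_. h j) i \<le> step_time (\<lambda>_. h j) 0 + T" for i
        using mult_left_mono[OF bound[of i j T], of "h j"] that h[of j] by (simp add: ySuc tau mult.commute)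
    qed (use h c(1) R0 in auto)
    then show ?thesis by (simp add: Y_def)
  qed
  have Y0: "Y j 0 = p" for j
    using interpolated_step_time[of "\<lambda>_. h j" "\<lambda>i (_::unit). y j i" "()" 0] h y0 by (simp add: Y_def)
  have inc: "\<forall>\<^sub>F j in sequentially. almost_inclusion F e T (Y j)" if e: "e > 0" and T: "T \<ge> 0" for e T
  proof -
    \<comment> \<open>The second entry is the smallness condition of
      \<open>almost_inclusion_interpolated\<close> for velocity bound \<open>c * R T\<close> and
      zero noise; the summand 1 keeps the denominator positive.\<close>
    define q where "q = min e (e / (3 * (c * R T) + 1))"
    have cR: "0 \<le> c * R T" using c(1) R0 by simp
    then have "q > 0" using e by (simp add: q_def add_nonneg_pos)
    then have "\<forall>\<^sub>F j in sequentially. h j < q" by (rule order_tendstoD(2)[OF h_lim])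
    then show ?thesis
    proof eventually_elim
      case (elim j)
      have he: "h j \<le> e" "h j \<le> e / (3 * (c * R T) + 1)" using elim by (auto simp: q_def)
      then have "h j * (3 * (c * R T) + 1) \<le> e" using cR by (simp add: pos_le_divide_eq)
      then have hc: "h j * (3 * (c * R T)) \<le> e" using h[of j] by (simp add: distrib_left)
      have "almost_inclusion F e T (\<lambda>t. interpolated (\<lambda>_. h j) (\<lambda>i (_::unit). y j i) () (step_time (\<lambda>_. h j) 0 + t))"
      proof (rule almost_inclusion_interpolated[where u = "\<lambda>_. 0" and v = "\<lambda>i. f (y j i)" and h = "h j" and d = 0 and K = 0 and R = "c * R T", OF _ tau_lim])
        show "f (y j i) \<in> enlarge F e (y j i)" for i
          using e f by (auto simp: enlarge_def intro!: bexI[of _ "y j i"])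
      qed (use h bound he hc in \<open>auto simp: ySuc tau\<close>)
      then show ?case by (simp add: Y_def)
    qed
  qed
  obtain k z where k: "strict_mono (k::nat \<Rightarrow> nat)" and lim: "\<And>t. 0 \<le> t \<Longrightarrow> (\<lambda>j. Y (k j) t) \<longlonglongrightarrow> z t"
  proof (rule lipschitz_convergent_subsequence[of Y])
    show "\<exists>L. \<forall>j. L-lipschitz_on {0..T} (Y j)" if "T \<ge> 0" for T
      using lip[OF that] by blast
    show "bounded (range (\<lambda>j. Y j 0))" by (simp add: Y0)
  qed blast
  have "quotients_approach F z t" if "t > 0" for t
  proof (rule quotients_approach_limit[OF F that, of "t + 1" "\<lambda>j. Y (k j)"])
    fix e :: real assume "e > 0"
    then show "\<forall>\<^sub>F j in sequentially. almost_inclusion F e (t + 1) (Y (k j))"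
      using that eventually_subseq[OF k inc[of e "t + 1"]] by simp
  qed (use lim lip[of "t + 1"] that in auto)
  moreover have "\<exists>L. L-lipschitz_on {0..T} z" for T
  proof (cases "0 \<le> T")
    case True
    then show ?thesis
      by (intro exI[of _ "c * R T"] lipschitz_on_limit[of "{0..T}" "\<lambda>j. Y (k j)" z] lip lim) auto
  next
    case False
    then show ?thesis by (intro exI[of _ 0]) simp
  qed
  moreover have "z 0 = p" using lim[of 0] by (simp add: Y0 LIMSEQ_const_iff)
  ultimately show thesis using that by (auto simp: forward_solution_def)
qed

section \<open>Shadowing and absorption by the attractor\<close>

lemma norm_enlarge_le:
  assumes F: "standard_map F" and c: "c \<ge> 0" "\<And>x z. z \<in> F x \<Longrightarrow> norm z \<le> c * (1 + norm x)"
    and v: "v \<in> enlarge F 1 y"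
  shows "norm v \<le> c * (2 + norm y) + 1"
proof -
  obtain z where z: "dist y z < 1" "infdist v (F z) < 1"
    using v by (auto simp: enlarge_def)
  obtain w where w: "w \<in> F z" "infdist v (F z) = dist v w"
    using infdist_attains_inf[of "F z" v] standard_map_values[OF F, of z] by blast
  have "norm z \<le> 1 + norm y"
    using norm_triangle_sub[of z y] z(1) by (simp add: dist_norm norm_minus_commute)
  then have "c * (1 + norm z) \<le> c * (2 + norm y)"
    using c(1) by (intro mult_left_mono) auto
  then have "norm w \<le> c * (2 + norm y)" using c(2)[OF w(1)] by linarith
  then show ?thesis
    using norm_triangle_sub[of v w] z(2) w(2) by (simp add: dist_norm)
qed

text \<open>Phrased through step times, this window condition can be compared both with the almost
  sure condition and with \<open>noise_event\<close>.\<close>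

definition small_noise :: "(nat \<Rightarrow> real) \<Rightarrow> (nat \<Rightarrow> 'w \<Rightarrow> real^'m) \<Rightarrow> 'w \<Rightarrow> nat \<Rightarrow> real \<Rightarrow> real \<Rightarrow> bool" where
  "small_noise \<gamma> U \<omega> n e T \<longleftrightarrow> (\<forall>k\<ge>n. step_time \<gamma> k \<le> step_time \<gamma> n + T \<longrightarrow>
     norm (\<Sum>i=n..<k. \<gamma> (Suc i) *\<^sub>R U (Suc i) \<omega>) \<le> e)"

lemma small_noise_mono:
  assumes "small_noise \<gamma> U \<omega> n d S" "d \<le> e" "T \<le> S"
  shows "small_noise \<gamma> U \<omega> n e T"
  using assms unfolding small_noise_def by (meson add_left_mono order_trans)

section \<open>Estimates uniform in the sample point\<close>

locale generalised_approximation =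
  fixes P :: "'w measure" and \<F> :: "nat \<Rightarrow> 'w measure"
    and M :: "(real^'m) set" and F :: "real^'m \<Rightarrow> (real^'m) set"
    and G :: "nat \<Rightarrow> real^'m \<Rightarrow> (real^'m) set"
    and \<gamma> :: "nat \<Rightarrow> real" and U x :: "nat \<Rightarrow> 'w \<Rightarrow> real^'m"
  assumes M: "compact M" and F: "standard_map F" and approx: "gen_stoch_approx P \<F> M F G \<gamma> U x"
begin

abbreviation "\<tau> \<equiv> step_time \<gamma>"

lemma pos: "\<gamma> n > 0"
  and gamma_lim: "\<gamma> \<longlonglongrightarrow> 0"
  and tau_lim: "filterlim \<tau> at_top sequentially"
  and x_in: "\<omega> \<in> space P \<Longrightarrow> x n \<omega> \<in> M"
  and noise_lim: "T > 0 \<Longrightarrow> AE \<omega> in P.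
        (\<lambda>n. SUP k\<in>{k. n \<le> k \<and> (\<Sum>i=n..<k. \<gamma> i) \<le> T}.
           ennreal (norm (\<Sum>i=n..<k. \<gamma> (Suc i) *\<^sub>R U (Suc i) \<omega>))) \<longlonglongrightarrow> 0"
  using approx unfolding gen_stoch_approx_def by (auto intro: filterlim_step_time)

lemma tau_mono: "strict_mono \<tau>"
  using step_time_strict_mono[of \<gamma>] pos by blast

lemma tau_le_iff: "\<tau> a \<le> \<tau> b \<longleftrightarrow> a \<le> b" and tau_less_iff: "\<tau> a < \<tau> b \<longleftrightarrow> a < b"
  using tau_mono by (simp_all add: strict_mono_less_eq strict_mono_less)

lemma tau_nonneg: "0 \<le> \<tau> n"
  using tau_le_iff[of 0 n] by simp

text \<open>Reading the velocity off the recursion takes the place of choosing an element of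
  \<open>G i (x i \<omega>)\<close>.\<close>

definition drift :: "nat \<Rightarrow> 'w \<Rightarrow> real^'m" where
  "drift i \<omega> = (x (Suc i) \<omega> - x i \<omega> - \<gamma> (Suc i) *\<^sub>R U (Suc i) \<omega>) /\<^sub>R \<gamma> (Suc i)"

lemma step_eq: "x (Suc i) \<omega> - x i \<omega> = \<gamma> (Suc i) *\<^sub>R (drift i \<omega> + U (Suc i) \<omega>)"
  using pos[of "Suc i"] by (simp add: drift_def scaleR_add_right)

lemma drift_eventually:
  assumes "e > 0"
  obtains n0 where "\<And>i \<omega>. n0 \<le> i \<Longrightarrow> \<omega> \<in> space P \<Longrightarrow> drift i \<omega> \<in> enlarge F e (x i \<omega>)"
proof -
  obtain n0 where n0: "\<forall>i\<ge>n0. \<forall>\<omega>\<in>space P. G i (x i \<omega>) \<subseteq> enlarge F e (x i \<omega>)"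
    using approx assms unfolding gen_stoch_approx_def by blast
  have "drift i \<omega> \<in> G i (x i \<omega>)" if "\<omega> \<in> space P" for i \<omega>
  proof -
    have "x (Suc i) \<omega> - x i \<omega> - \<gamma> (Suc i) *\<^sub>R U (Suc i) \<omega> \<in> (\<lambda>z. \<gamma> (Suc i) *\<^sub>R z) ` G i (x i \<omega>)"
      using approx that unfolding gen_stoch_approx_def by blast
    then show ?thesis using pos[of "Suc i"] by (auto simp: drift_def)
  qed
  then show thesis using that n0 by blast
qed

lemma bounds:
  obtains n0 R K where "0 \<le> R" "0 \<le> K"
    "\<And>i \<omega>. n0 \<le> i \<Longrightarrow> \<omega> \<in> space P \<Longrightarrow> norm (drift i \<omega>) \<le> R"
    "\<And>i \<omega>. \<omega> \<in> space P \<Longrightarrow> norm (U i \<omega>) \<le> K"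
    "\<And>i \<omega>. n0 \<le> i \<Longrightarrow> \<omega> \<in> space P \<Longrightarrow> norm (x (Suc i) \<omega> - x i \<omega>) \<le> (R + K) * \<gamma> (Suc i)"
proof -
  obtain c where c: "c > 0" "\<And>x z. z \<in> F x \<Longrightarrow> norm z \<le> c * (1 + norm x)"
    using standard_map_growth[OF F] by blast
  obtain r where r: "r > 0" "\<And>y. y \<in> M \<Longrightarrow> norm y \<le> r"
    using M compact_imp_bounded bounded_pos by metis
  have "\<exists>K. \<forall>n. \<forall>\<omega>\<in>space P. norm (U n \<omega>) \<le> K"
    using approx unfolding gen_stoch_approx_def by (rule conjunct1)
  then obtain K' where K': "\<And>n \<omega>. \<omega> \<in> space P \<Longrightarrow> norm (U n \<omega>) \<le> K'"
    by blast
  \<comment> \<open>On an empty sample space \<open>K'\<close> could be negative.\<close>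
  define K where "K = max K' 0"
  have K: "norm (U n \<omega>) \<le> K" if "\<omega> \<in> space P" for n \<omega>
    using K'[OF that, of n] by (simp add: K_def)
  obtain n0 where n0: "\<And>i \<omega>. n0 \<le> i \<Longrightarrow> \<omega> \<in> space P \<Longrightarrow> drift i \<omega> \<in> enlarge F 1 (x i \<omega>)"
    using drift_eventually[of 1] by auto
  define R where "R = c * (2 + r) + 1"
  have R: "norm (drift i \<omega>) \<le> R" if "n0 \<le> i" "\<omega> \<in> space P" for i \<omega>
  proof -
    have "norm (drift i \<omega>) \<le> c * (2 + norm (x i \<omega>)) + 1"
      using c by (intro norm_enlarge_le[OF F _ _ n0[OF that]]) auto
    moreover have "c * (2 + norm (x i \<omega>)) \<le> c * (2 + r)"
      using r(2)[OF x_in[OF that(2)]] c(1) by (intro mult_left_mono) auto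
    ultimately show ?thesis by (simp add: R_def)
  qed
  have "norm (x (Suc i) \<omega> - x i \<omega>) \<le> (R + K) * \<gamma> (Suc i)" if "n0 \<le> i" "\<omega> \<in> space P" for i \<omega>
  proof -
    have "norm (x (Suc i) \<omega> - x i \<omega>) = norm (drift i \<omega> + U (Suc i) \<omega>) * \<gamma> (Suc i)"
      using pos[of "Suc i"] by (simp add: step_eq)
    also have "\<dots> \<le> (R + K) * \<gamma> (Suc i)"
      using R[OF that] K[OF that(2), of "Suc i"] pos[of "Suc i"] norm_triangle_ineq[of "drift i \<omega>" "U (Suc i) \<omega>"]
      by (intro mult_right_mono) auto
    finally show ?thesis .
  qed
  moreover have "0 \<le> R" "0 \<le> K" using c r by (auto simp: R_def K_def)
  ultimately show thesis using that R K by blast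
qed

lemma step_lim:
  assumes "\<omega> \<in> space P" shows "(\<lambda>i. norm (x (Suc i) \<omega> - x i \<omega>)) \<longlonglongrightarrow> 0"
proof -
  obtain n0 R K where *: "\<And>i \<omega>. n0 \<le> i \<Longrightarrow> \<omega> \<in> space P \<Longrightarrow> norm (x (Suc i) \<omega> - x i \<omega>) \<le> (R + K) * \<gamma> (Suc i)"
    using bounds by metis
  have lim: "(\<lambda>i. (R + K) * \<gamma> (Suc i)) \<longlonglongrightarrow> 0"
    using LIMSEQ_Suc[OF gamma_lim] by (rule tendsto_mult_right_zero)
  show ?thesis
    by (rule tendsto_sandwich[OF _ _ tendsto_const lim])
      (use * assms in \<open>auto simp: eventually_sequentially\<close>)
qed

lemma eventually_gamma_le:
  assumes "e > 0" obtains N where "\<And>i. N \<le> i \<Longrightarrow> \<gamma> i \<le> e"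
  using order_tendstoD(2)[OF gamma_lim assms] less_imp_le unfolding eventually_sequentially by metis

text \<open>Failure for all thresholds gives windows with ever later starts, ever smaller noise and
  changing sample points. Compactness of \<open>M\<close> bounds the starting points, so a
  subsequence converges to a curve that starts in \<open>B\<close> and is, on \<open>{0..T}\<close>,
  a solution; at a limit of the violating times it lies in \<open>V\<close>, which is open.\<close>

lemma shadowing:
  assumes B: "closed B" "B \<noteq> {}" and V: "open V" and T: "0 \<le> T0" "T0 \<le> T"
    and flow: "\<And>q t. q \<in> B \<Longrightarrow> T0 \<le> t \<Longrightarrow> t \<le> T \<Longrightarrow> flow F t q \<subseteq> V"
  shows "\<exists>J. \<exists>e>0. \<forall>n\<ge>J. \<forall>\<omega>\<in>space P. infdist (x n \<omega>) B \<le> e \<longrightarrow> small_noise \<gamma> U \<omega> n e T \<longrightarrow>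
    (\<forall>m. \<tau> n + T0 \<le> \<tau> m \<and> \<tau> m \<le> \<tau> n + T \<longrightarrow> x m \<omega> \<in> V)"
proof (rule ccontr)
  assume contra: "\<not> ?thesis"
  obtain n0 R K where R0: "0 \<le> R" and K0: "0 \<le> K"
    and R: "\<And>i \<omega>. n0 \<le> i \<Longrightarrow> \<omega> \<in> space P \<Longrightarrow> norm (drift i \<omega>) \<le> R"
    and K: "\<And>i \<omega>. \<omega> \<in> space P \<Longrightarrow> norm (U i \<omega>) \<le> K"
    and L: "\<And>i \<omega>. n0 \<le> i \<Longrightarrow> \<omega> \<in> space P \<Longrightarrow> norm (x (Suc i) \<omega> - x i \<omega>) \<le> (R + K) * \<gamma> (Suc i)"
    using bounds by metis
  \<comment> \<open>Starting beyond \<open>j + n0\<close> makes the step bounds valid throughout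
    every window.\<close>
  have "\<exists>n \<omega> m. j + n0 \<le> n \<and> \<omega> \<in> space P \<and> infdist (x n \<omega>) B \<le> 1 / real (Suc j) \<and>
      small_noise \<gamma> U \<omega> n (1 / real (Suc j)) T \<and> \<tau> n + T0 \<le> \<tau> m \<and> \<tau> m \<le> \<tau> n + T \<and> x m \<omega> \<notin> V" for j
  proof -
    have "1 / real (Suc j) > 0" by simp
    then show ?thesis using contra by blast
  qed
  then obtain n \<omega> m where nn: "\<And>j. j + n0 \<le> n j" and om: "\<And>j. \<omega> j \<in> space P"
    and infd: "\<And>j. infdist (x (n j) (\<omega> j)) B \<le> 1 / real (Suc j)"
    and noise: "\<And>j. small_noise \<gamma> U (\<omega> j) (n j) (1 / real (Suc j)) T"
    and m: "\<And>j. \<tau> (n j) + T0 \<le> \<tau> (m j)" "\<And>j. \<tau> (m j) \<le> \<tau> (n j) + T" "\<And>j. x (m j) (\<omega> j) \<notin> V"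
    by metis
  have inv_lim: "(\<lambda>j. 1 / real (Suc j)) \<longlonglongrightarrow> 0"
    using LIMSEQ_inverse_real_of_nat by (simp add: inverse_eq_divide)
  define Y where "Y j t = interpolated \<gamma> x (\<omega> j) (\<tau> (n j) + t)" for j t
  define t where "t j = \<tau> (m j) - \<tau> (n j)" for j
  have t: "t j \<in> {T0..T}" for j using m(1,2)[of j] by (simp add: t_def)
  \<comment> \<open>The violating times converge along \<open>k1\<close>; \<open>k2\<close> then
    extracts convergent curves.\<close>
  obtain s k1 where s: "s \<in> {T0..T}" and k1: "strict_mono (k1 :: nat \<Rightarrow> nat)" "(t \<circ> k1) \<longlonglongrightarrow> s"
    using compact_Icc[of T0 T] t unfolding compact_def by meson
  have lip: "(R + K)-lipschitz_on {0..S} (Y j)" if "0 \<le> S" for S j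
    unfolding Y_def
    using L om nn[of j] R0 K0 by (intro lipschitz_on_interpolated pos tau_lim that) auto
  have Y0: "Y j 0 = x (n j) (\<omega> j)" for j
    using pos by (simp add: Y_def)
  have "bounded (range (\<lambda>j. Y (k1 j) 0))"
    using compact_imp_bounded[OF M] by (rule bounded_subset) (auto simp: Y0 x_in om)
  then obtain k2 z where k2: "strict_mono (k2 :: nat \<Rightarrow> nat)"
    and lim': "\<And>t. 0 \<le> t \<Longrightarrow> (\<lambda>j. Y (k1 (k2 j)) t) \<longlonglongrightarrow> z t"
    using lipschitz_convergent_subsequence[of "\<lambda>j. Y (k1 j)"] lip by metis
  define k where "k = k1 \<circ> k2"
  have k: "strict_mono k" using k1(1) k2 by (simp add: k_def strict_mono_o)
  have lim: "(\<lambda>j. Y (k j) t) \<longlonglongrightarrow> z t" if "0 \<le> t" for t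
    using lim'[OF that] by (simp add: k_def)
  have inc: "\<forall>\<^sub>F j in sequentially. almost_inclusion F e T (Y j)" if e: "e > 0" for e
  proof -
    obtain n1 where n1: "\<And>i \<omega>. n1 \<le> i \<Longrightarrow> \<omega> \<in> space P \<Longrightarrow> drift i \<omega> \<in> enlarge F e (x i \<omega>)"
      using drift_eventually[OF e] by blast
    \<comment> \<open>Step sizes below \<open>q\<close> use up \<open>e / 2\<close> of the permitted
      error; twice a noise below \<open>e / 4\<close> uses the rest.\<close>
    define q where "q = min e (e / (2 * (3 * R + 2 * K + 1)))"
    have q: "q > 0" "q \<le> e" using e R0 K0 by (auto simp: q_def)
    have "q \<le> e / (2 * (3 * R + 2 * K + 1))" by (simp add: q_def)
    then have "q * (2 * (3 * R + 2 * K + 1)) \<le> e" using R0 K0 by (simp add: pos_le_divide_eq)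
    then have qe: "q * (3 * R + 2 * K) \<le> e / 2" using q(1) by (simp add: algebra_simps)
    obtain n2 where n2: "\<And>i. n2 \<le> i \<Longrightarrow> \<gamma> i \<le> q" using eventually_gamma_le[OF q(1)] by blast
    have "\<forall>\<^sub>F j in sequentially. 1 / real (Suc j) < e / 4"
      using order_tendstoD(2)[OF inv_lim, of "e / 4"] e by simp
    moreover have "\<forall>\<^sub>F j in sequentially. n1 \<le> j" "\<forall>\<^sub>F j in sequentially. n2 \<le> j"
      by (rule eventually_ge_at_top)+
    ultimately show ?thesis
    proof eventually_elim
      case (elim j)
      show ?case unfolding Y_def
      proof (rule almost_inclusion_interpolated[where \<gamma> = \<gamma> and x = x and \<omega> = "\<omega> j" and n = "n j" and v = "\<lambda>i. drift i (\<omega> j)" and u = "\<lambda>i. U (Suc i) (\<omega> j)"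
            and h = q and d = "1 / real (Suc j)" and R = R and K = K, OF pos tau_lim step_eq])
        show "drift i (\<omega> j) \<in> enlarge F e (x i (\<omega> j))" if "n j \<le> i" for i
          using n1[of i] om elim(2) nn[of j] that by simp
        show "norm (drift i (\<omega> j)) \<le> R" if "n j \<le> i" for i
          using R[of i] om nn[of j] that by simp
        show "norm (U (Suc i) (\<omega> j)) \<le> K" for i by (rule K[OF om])
        show "\<gamma> (Suc i) \<le> q" if "n j \<le> i" for i
          using n2[of "Suc i"] elim(3) nn[of j] that by simp
        show "norm (\<Sum>i=n j..<k. \<gamma> (Suc i) *\<^sub>R U (Suc i) (\<omega> j)) \<le> 1 / real (Suc j)"
          if "n j \<le> k" "\<tau> k \<le> \<tau> (n j) + T" for k
          using noise[of j] that unfolding small_noise_def by blast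
        show "q * (3 * R + 2 * K) + 2 * (1 / real (Suc j)) \<le> e" using qe elim(1) by linarith
      qed (rule q(2))
    qed
  qed
  have T0: "0 \<le> T" using T by simp
  have lipz: "(R + K)-lipschitz_on {0..T} z"
    by (rule lipschitz_on_limit[of _ "\<lambda>j. Y (k j)"]) (use lim lip[OF T0] in auto)
  have quot: "quotients_approach F z t" if "0 < t" "t < T" for t
    by (rule quotients_approach_limit[OF F that lim lip[OF T0]]) (auto intro: eventually_subseq[OF k inc])
  obtain y where y: "forward_solution (\<lambda>x. uminus ` F x) y" "y 0 = z 0"
    using forward_solution_exists[OF standard_map_uminus[OF F]] by blast
  obtain w where w: "forward_solution F w" "w 0 = z T"
    using forward_solution_exists[OF F] by blast
  obtain X where X: "X \<in> solutions_from F (z 0)" "\<And>t. t \<in> {0..T} \<Longrightarrow> X t = z t"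
    using solution_glue[OF F T0 lipz quot y w] by blast
  have "(\<lambda>j. infdist (Y (k j) 0) B) \<longlonglongrightarrow> infdist (z 0) B"
    by (intro tendsto_infdist lim) simp
  moreover have "(\<lambda>j. infdist (Y (k j) 0) B) \<longlonglongrightarrow> 0"
    by (rule tendsto_sandwich[OF _ _ tendsto_const LIMSEQ_subseq_LIMSEQ[OF inv_lim k]])
      (use infd in \<open>auto simp: Y0 infdist_nonneg o_def simp del: of_nat_Suc\<close>)
  ultimately have "infdist (z 0) B = 0" by (rule LIMSEQ_unique)
  then have zB: "z 0 \<in> B" using B by (simp add: in_closed_iff_infdist_zero)
  have s0: "0 \<le> s" "s \<le> T" using s T by auto
  have "X s \<in> flow F s (z 0)" using X(1) unfolding flow_def by blast
  then have zV: "z s \<in> V" using flow[OF zB, of s] s X(2)[of s] s0 by auto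
  have tk: "(\<lambda>j. t (k j)) \<longlonglongrightarrow> s"
    using LIMSEQ_subseq_LIMSEQ[OF k1(2) k2] by (simp add: o_def k_def)
  \<comment> \<open>The curves are evaluated at moving times; their common Lipschitz constant
    reduces this to convergence at \<open>s\<close>.\<close>
  have "(\<lambda>j. Y (k j) (t (k j)) - Y (k j) s) \<longlonglongrightarrow> 0"
  proof (rule Lim_null_comparison)
    have "norm (Y (k j) (t (k j)) - Y (k j) s) \<le> (R + K) * norm (t (k j) - s)" for j
      using lipschitz_on_normD[OF lip[OF T0], of "t (k j)" s] t[of "k j"] s0 T by auto
    then show "\<forall>\<^sub>F j in sequentially. norm (Y (k j) (t (k j)) - Y (k j) s) \<le> (R + K) * norm (t (k j) - s)"
      by simp
    show "(\<lambda>j. (R + K) * norm (t (k j) - s)) \<longlonglongrightarrow> 0"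
      by (intro tendsto_mult_right_zero tendsto_norm_zero[OF LIM_zero[OF tk]])
  qed
  from tendsto_add[OF this lim[OF s0(1)]] have "(\<lambda>j. Y (k j) (t (k j))) \<longlonglongrightarrow> z s" by simp
  then have "\<forall>\<^sub>F j in sequentially. Y (k j) (t (k j)) \<in> V" using V zV by (rule topological_tendstoD)
  then obtain j where "Y (k j) (t (k j)) \<in> V" by (auto simp: eventually_sequentially)
  moreover have "Y (k j) (t (k j)) = x (m (k j)) (\<omega> (k j))" using pos by (simp add: Y_def t_def)
  ultimately show False using m(3) by simp
qed

text \<open>With steps of at most 1, looking back by a time in \<open>[t, t + 1]\<close> always hits
  an iterate; this is the origin of the additional 1 in the horizons.\<close>

lemma earlier_index:
  assumes "\<And>i. n \<le> i \<Longrightarrow> \<gamma> i \<le> 1" and "\<tau> n + t \<le> \<tau> m"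
  obtains m' where "n \<le> m'" "\<tau> m' + t \<le> \<tau> m" "\<tau> m \<le> \<tau> m' + (t + 1)"
proof -
  have "0 \<le> \<tau> m - t" using assms(2) tau_nonneg[of n] by simp
  then obtain i where i: "\<tau> i \<le> \<tau> m - t" "\<tau> m - t < \<tau> (Suc i)"
    using step_time_bracket[OF tau_lim] by blast
  then have "n \<le> i" using assms(2) tau_less_iff[of n "Suc i"] by simp
  moreover have "\<gamma> (Suc i) \<le> 1" using assms(1) \<open>n \<le> i\<close> by simp
  ultimately show thesis using that[of i] i by (simp add: step_time_Suc)
qed

text \<open>Shadowing from \<open>n\<close> covers the iterates between times \<open>t\<close> and
  \<open>2 * t + 1\<close> after it. A later iterate is reached from an earlier one which, by
  induction, already lies in \<open>V\<close> and hence in \<open>B\<close>, so errors do not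
  accumulate and one threshold \<open>e\<close> suffices.\<close>

lemma absorption:
  assumes t: "t > 0" and B: "closed B" "B \<noteq> {}" and V: "open V" "V \<subseteq> B"
    and flow: "\<And>q s. q \<in> B \<Longrightarrow> s \<ge> t \<Longrightarrow> flow F s q \<subseteq> V"
  shows "\<exists>J. \<exists>e>0. \<forall>n\<ge>J. \<forall>\<omega>\<in>space P. x n \<omega> \<in> B \<longrightarrow> (\<forall>k\<ge>n. small_noise \<gamma> U \<omega> k e (2 * t + 1)) \<longrightarrow>
    (\<forall>\<^sub>F m in sequentially. x m \<omega> \<in> B)"
proof -
  obtain J e where e: "e > 0" and J: "\<And>n \<omega> m. J \<le> n \<Longrightarrow> \<omega> \<in> space P \<Longrightarrow> infdist (x n \<omega>) B \<le> e \<Longrightarrow>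
      small_noise \<gamma> U \<omega> n e (2 * t + 1) \<Longrightarrow> \<tau> n + t \<le> \<tau> m \<Longrightarrow> \<tau> m \<le> \<tau> n + (2 * t + 1) \<Longrightarrow> x m \<omega> \<in> V"
    using shadowing[OF B V(1), of t "2 * t + 1"] flow t by fastforce
  obtain N where N: "\<And>i. N \<le> i \<Longrightarrow> \<gamma> i \<le> 1" using eventually_gamma_le[of 1] by auto
  have "\<forall>\<^sub>F m in sequentially. x m \<omega> \<in> B"
    if n: "max J N \<le> n" and om: "\<omega> \<in> space P" and xB: "x n \<omega> \<in> B"
      and noise: "\<And>k. n \<le> k \<Longrightarrow> small_noise \<gamma> U \<omega> k e (2 * t + 1)" for n \<omega>
  proof -
    have xV: "x m \<omega> \<in> V" if "\<tau> n + t \<le> \<tau> m" for m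
      using that
    proof (induction m rule: less_induct)
      case (less m)
      show ?case
      proof (cases "\<tau> m \<le> \<tau> n + (2 * t + 1)")
        case True
        then show ?thesis using J[of n \<omega> m] n om xB noise less.prems e by simp
      next
        case False
        obtain m' where m': "n \<le> m'" "\<tau> m' + t \<le> \<tau> m" "\<tau> m \<le> \<tau> m' + (t + 1)"
          using earlier_index[of n t m] N n less.prems by auto
        have "m' < m" using m'(2) t tau_less_iff[of m' m] by simp
        \<comment> \<open>The horizon \<open>2 * t + 1\<close> is made for this: \<open>m\<close> is
          more than that after \<open>n\<close> but at most \<open>t + 1\<close> after
          \<open>m'\<close>, so \<open>m'\<close> is itself at least \<open>t\<close> after
          \<open>n\<close>.\<close>
        moreover have "\<tau> n + t \<le> \<tau> m'" using False m'(3) by simp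
        ultimately have "x m' \<omega> \<in> B" using less.IH V(2) by blast
        then show ?thesis using J[of m' \<omega> m] n m' om noise[of m'] e t by simp
      qed
    qed
    have "\<forall>\<^sub>F m in sequentially. \<tau> n + t \<le> \<tau> m"
      using tau_lim unfolding filterlim_at_top by blast
    then show ?thesis by eventually_elim (use xV V(2) in blast)
  qed
  then show ?thesis using e by blast
qed

text \<open>All late iterates are in \<open>B\<close>, so each later one can be shadowed from one in
  \<open>B\<close>. The threshold \<open>e\<close> depends on \<open>V\<close>, whence the eventual
  smallness of the noise at every level.\<close>

lemma convergence:
  assumes t: "t > 0" and B: "closed B" "B \<noteq> {}" and V: "open V"
    and flow: "\<And>q s. q \<in> B \<Longrightarrow> s \<ge> t \<Longrightarrow> flow F s q \<subseteq> V"
    and om: "\<omega> \<in> space P" and xB: "\<forall>\<^sub>F m in sequentially. x m \<omega> \<in> B"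
    and noise: "\<And>e T. e > 0 \<Longrightarrow> T > 0 \<Longrightarrow> \<forall>\<^sub>F n in sequentially. small_noise \<gamma> U \<omega> n e T"
  shows "\<forall>\<^sub>F m in sequentially. x m \<omega> \<in> V"
proof -
  obtain J e where e: "e > 0" and J: "\<And>n \<omega> m. J \<le> n \<Longrightarrow> \<omega> \<in> space P \<Longrightarrow> infdist (x n \<omega>) B \<le> e \<Longrightarrow>
      small_noise \<gamma> U \<omega> n e (t + 1) \<Longrightarrow> \<tau> n + t \<le> \<tau> m \<Longrightarrow> \<tau> m \<le> \<tau> n + (t + 1) \<Longrightarrow> x m \<omega> \<in> V"
    using shadowing[OF B V(1), of t "t + 1"] flow t by fastforce
  obtain N where N: "\<And>i. N \<le> i \<Longrightarrow> \<gamma> i \<le> 1" using eventually_gamma_le[of 1] by auto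
  have "\<forall>\<^sub>F n in sequentially. x n \<omega> \<in> B \<and> small_noise \<gamma> U \<omega> n e (t + 1)"
    using xB noise[of e "t + 1"] e t by (intro eventually_conj) auto
  then obtain n1 where n1: "\<And>n. n1 \<le> n \<Longrightarrow> x n \<omega> \<in> B" "\<And>n. n1 \<le> n \<Longrightarrow> small_noise \<gamma> U \<omega> n e (t + 1)"
    unfolding eventually_sequentially by blast
  define n where "n = max (max J N) n1"
  have xV: "x m \<omega> \<in> V" if m: "\<tau> n + t \<le> \<tau> m" for m
  proof -
    obtain m' where m': "n \<le> m'" "\<tau> m' + t \<le> \<tau> m" "\<tau> m \<le> \<tau> m' + (t + 1)"
      using earlier_index[of n t m] N m by (auto simp: n_def)
    then show ?thesis using J[of m' \<omega> m] n1[of m'] om e by (simp add: n_def)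
  qed
  have "\<forall>\<^sub>F m in sequentially. \<tau> n + t \<le> \<tau> m"
    using tau_lim unfolding filterlim_at_top by blast
  then show ?thesis by eventually_elim (rule xV)
qed

end

section \<open>Convergence with positive probability\<close>

context generalised_approximation
begin

text \<open>The almost sure condition measures a window by the sum of \<open>\<gamma> i\<close>,
  \<open>small_noise\<close> by that of \<open>\<gamma> (Suc i)\<close>. They differ by
  \<open>\<gamma> n - \<gamma> k\<close>, absorbed by one extra unit of horizon. Integer horizons
  give a common null set.\<close>

lemma AE_eventually_small_noise:
  "AE \<omega> in P. \<forall>e T. e > 0 \<longrightarrow> T > 0 \<longrightarrow> (\<forall>\<^sub>F n in sequentially. small_noise \<gamma> U \<omega> n e T)"
proof -
  have shift: "(\<Sum>i=n..<k. \<gamma> i) + \<gamma> k = \<gamma> n + (\<Sum>i=n..<k. \<gamma> (Suc i))" if "n \<le> k" for n k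
    using that by (induction k rule: dec_induct) auto
  have "\<forall>N::nat. AE \<omega> in P. (\<lambda>n. SUP k\<in>{k. n \<le> k \<and> (\<Sum>i=n..<k. \<gamma> i) \<le> real (Suc N)}.
           ennreal (norm (\<Sum>i=n..<k. \<gamma> (Suc i) *\<^sub>R U (Suc i) \<omega>))) \<longlonglongrightarrow> 0"
    by (intro allI noise_lim) simp
  then have "AE \<omega> in P. \<forall>N::nat. (\<lambda>n. SUP k\<in>{k. n \<le> k \<and> (\<Sum>i=n..<k. \<gamma> i) \<le> real (Suc N)}.
           ennreal (norm (\<Sum>i=n..<k. \<gamma> (Suc i) *\<^sub>R U (Suc i) \<omega>))) \<longlonglongrightarrow> 0"
    unfolding AE_all_countable .
  then show ?thesis
  proof (rule eventually_mono, intro allI impI)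
    fix \<omega> and e T :: real
    assume *: "\<forall>N::nat. (\<lambda>n. SUP k\<in>{k. n \<le> k \<and> (\<Sum>i=n..<k. \<gamma> i) \<le> real (Suc N)}.
           ennreal (norm (\<Sum>i=n..<k. \<gamma> (Suc i) *\<^sub>R U (Suc i) \<omega>))) \<longlonglongrightarrow> 0"
      and e: "e > 0" and T: "T > 0"
    obtain N where N: "T + 1 \<le> real N" using real_arch_simple by blast
    have "\<forall>\<^sub>F n in sequentially. (SUP k\<in>{k. n \<le> k \<and> (\<Sum>i=n..<k. \<gamma> i) \<le> real (Suc N)}.
           ennreal (norm (\<Sum>i=n..<k. \<gamma> (Suc i) *\<^sub>R U (Suc i) \<omega>))) < ennreal e"
      using *[rule_format, of N] e by (intro order_tendstoD(2)) auto
    moreover have "\<forall>\<^sub>F n in sequentially. \<gamma> n < 1"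
      using gamma_lim by (rule order_tendstoD) simp
    ultimately show "\<forall>\<^sub>F n in sequentially. small_noise \<gamma> U \<omega> n e T"
    proof eventually_elim
      case (elim n)
      show ?case unfolding small_noise_def
      proof (intro allI impI)
        fix k assume k: "n \<le> k" "\<tau> k \<le> \<tau> n + T"
        have "(\<Sum>i=n..<k. \<gamma> i) \<le> real (Suc N)"
          using shift[OF k(1)] step_time_diff[OF k(1), of \<gamma>] k(2) elim(2) pos[of k] N by simp
        then have "ennreal (norm (\<Sum>i=n..<k. \<gamma> (Suc i) *\<^sub>R U (Suc i) \<omega>)) < ennreal e"
          using k(1) by (intro le_less_trans[OF SUP_upper elim(1)]) simp
        then show "norm (\<Sum>i=n..<k. \<gamma> (Suc i) *\<^sub>R U (Suc i) \<omega>) \<le> e"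
          by (simp add: ennreal_less_iff)
      qed
    qed
  qed
qed

lemma small_noise_if_not_noise_event:
  assumes om: "\<omega> \<in> space P" "\<omega> \<notin> noise_event P \<gamma> U n e T" and e: "e > 0" and n: "n \<le> k'"
  shows "small_noise \<gamma> U \<omega> k' e T"
  unfolding small_noise_def
proof (intro allI impI)
  fix k assume k: "k' \<le> k" "\<tau> k \<le> \<tau> k' + T"
  show "norm (\<Sum>i=k'..<k. \<gamma> (Suc i) *\<^sub>R U (Suc i) \<omega>) \<le> e"
  \<comment> \<open>The inner supremum in \<open>noise_event\<close> runs over
    \<open>k > k'\<close>; for \<open>k = k'\<close> the sum is empty.\<close>
  proof (cases "k = k'")
    case False
    have "0 \<le> \<tau> k' + T" using k(2) tau_nonneg[of k] by simp
    then obtain i where i: "\<tau> i \<le> \<tau> k' + T" "\<tau> k' + T < \<tau> (Suc i)"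
      using step_time_bracket[OF tau_lim] by blast
    have "step_index \<gamma> (\<tau> k' + T) = i" using step_index_eq[OF pos i] .
    moreover have "k \<le> i" using k(2) i(2) tau_less_iff[of k "Suc i"] by simp
    ultimately have kin: "k \<in> {k'<..step_index \<gamma> (\<tau> k' + T)}" using k(1) False by simp
    have "ennreal (norm (\<Sum>i=k'..<k. \<gamma> (Suc i) *\<^sub>R U (Suc i) \<omega>))
        \<le> (SUP k'\<in>{n..}. SUP k\<in>{k'<..step_index \<gamma> (\<tau> k' + T)}.
            ennreal (norm (\<Sum>i=k'..<k. \<gamma> (Suc i) *\<^sub>R U (Suc i) \<omega>)))"
      using n by (intro SUP_upper2[of k'] SUP_upper[OF kin]) simp
    also have "\<dots> < ennreal e" using om by (simp add: noise_event_def not_le)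
    finally show ?thesis by (simp add: ennreal_less_iff)
  qed (use e in simp)
qed

text \<open>A countable condition on the iterates makes the event measurable and is the form in
  which convergence is proved. Compactness of \<open>M\<close> provides a limit point for iterates
  staying away from \<open>A\<close>; conversely, vanishing steps carry the distance bound over to
  the interpolated path.\<close>

lemma limit_set_subset_iff:
  assumes om: "\<omega> \<in> space P" and A: "compact A" "A \<noteq> {}"
  shows "limit_set (interpolated \<gamma> x \<omega>) \<subseteq> A \<longleftrightarrow>
    (\<forall>j::nat. \<exists>N. \<forall>m\<ge>N. infdist (x m \<omega>) A < 1 / real (Suc j))"
proof
  assume sub: "limit_set (interpolated \<gamma> x \<omega>) \<subseteq> A"
  show "\<forall>j::nat. \<exists>N. \<forall>m\<ge>N. infdist (x m \<omega>) A < 1 / real (Suc j)"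
  proof (rule ccontr)
    assume "\<not> ?thesis"
    then obtain j m where m: "\<And>N. N \<le> m N" "\<And>N. 1 / real (Suc j) \<le> infdist (x (m N) \<omega>) A"
      unfolding not_all not_ex not_less not_le by (metis not_less)
    obtain l r where r: "strict_mono (r :: nat \<Rightarrow> nat)" "((\<lambda>N. x (m N) \<omega>) \<circ> r) \<longlonglongrightarrow> l"
      using M x_in[OF om] unfolding compact_def by meson
    have r': "(\<lambda>N. x (m (r N)) \<omega>) \<longlonglongrightarrow> l" using r(2) by (simp add: o_def)
    have "l \<in> closure (interpolated \<gamma> x \<omega> ` {t..})" for t
    proof (rule Lim_in_closed_set[OF closed_closure _ sequentially_bot r'])
      have "N \<le> m (r N)" for N
        by (rule order_trans[OF seq_suble[OF r(1)] m(1)])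
      then have "filterlim (\<lambda>N. m (r N)) at_top sequentially"
        by (intro filterlim_at_top_mono[OF filterlim_ident] always_eventually allI)
      then have "filterlim (\<lambda>N. \<tau> (m (r N))) at_top sequentially"
        by (rule filterlim_compose[OF tau_lim])
      then have "\<forall>\<^sub>F N in sequentially. t \<le> \<tau> (m (r N))" unfolding filterlim_at_top by blast
      then show "\<forall>\<^sub>F N in sequentially. x (m (r N)) \<omega> \<in> closure (interpolated \<gamma> x \<omega> ` {t..})"
      proof eventually_elim
        case (elim N)
        have "interpolated \<gamma> x \<omega> (\<tau> (m (r N))) \<in> interpolated \<gamma> x \<omega> ` {t..}" using elim by blast
        from subsetD[OF closure_subset this] show ?case using pos by simp
      qed
    qed
    then have "l \<in> A" using sub by (auto simp: limit_set_def)
    moreover have "1 / real (Suc j) \<le> infdist l A"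
      by (rule tendsto_lowerbound[OF tendsto_infdist[OF r']]) (use m(2) in auto)
    ultimately show False by simp
  qed
next
  assume *: "\<forall>j::nat. \<exists>N. \<forall>m\<ge>N. infdist (x m \<omega>) A < 1 / real (Suc j)"
  show "limit_set (interpolated \<gamma> x \<omega>) \<subseteq> A"
  proof
    fix q assume q: "q \<in> limit_set (interpolated \<gamma> x \<omega>)"
    have "infdist q A \<le> 0 + e" if e: "e > 0" for e
    proof -
      obtain j where j: "1 / real (Suc j) < e / 2" using nat_approx_posE[of "e / 2"] e by auto
      obtain N1 where N1: "\<And>m. N1 \<le> m \<Longrightarrow> infdist (x m \<omega>) A < 1 / real (Suc j)" using * by blast
      have "\<forall>\<^sub>F i in sequentially. norm (x (Suc i) \<omega> - x i \<omega>) < e / 2"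
        using e by (intro order_tendstoD(2)[OF step_lim[OF om]]) simp
      then obtain N2 where N2: "\<And>i. N2 \<le> i \<Longrightarrow> norm (x (Suc i) \<omega> - x i \<omega>) < e / 2"
        unfolding eventually_sequentially by blast
      define N where "N = max N1 N2"
      have "infdist (interpolated \<gamma> x \<omega> t) A \<le> e" if t: "\<tau> N \<le> t" for t
      proof -
        obtain i where i: "\<tau> i \<le> t" "t < \<tau> (Suc i)"
          using step_time_bracket[OF tau_lim] tau_nonneg[of N] t by (metis order_trans)
        then have iN: "N \<le> i" using t tau_less_iff[of N "Suc i"] by simp
        have "dist (interpolated \<gamma> x \<omega> t) (x i \<omega>) \<le> norm (x (Suc i) \<omega> - x i \<omega>)"
          unfolding dist_norm using i pos by (intro norm_interpolated_diff_le) auto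
        then show ?thesis
          using infdist_triangle[of "interpolated \<gamma> x \<omega> t" A "x i \<omega>"] N1[of i] N2[of i] iN j
          by (simp add: N_def)
      qed
      then have "interpolated \<gamma> x \<omega> ` {\<tau> N..} \<subseteq> {y. infdist y A \<le> e}" by auto
      moreover have "closed {y. infdist y A \<le> e}"
        by (intro closed_Collect_le continuous_intros)
      ultimately have "closure (interpolated \<gamma> x \<omega> ` {\<tau> N..}) \<subseteq> {y. infdist y A \<le> e}"
        by (rule closure_minimal)
      moreover have "q \<in> closure (interpolated \<gamma> x \<omega> ` {\<tau> N..})"
        using q tau_nonneg[of N] unfolding limit_set_def by blast
      ultimately show ?thesis by auto
    qed
    then have "infdist q A \<le> 0" by (rule field_le_epsilon)
    then have "infdist q A = 0" using infdist_nonneg by (rule antisym)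
    then show "q \<in> A" using A by (simp add: in_closed_iff_infdist_zero compact_imp_closed)
  qed
qed

end

section \<open>Uniform attraction, entry from the basin, conditional estimate\<close>

lemma attractor_uniform:
  assumes "attractor F A"
  obtains r where "r > 0" "\<And>e. e > 0 \<Longrightarrow> \<exists>t>0. \<forall>s\<ge>t. \<forall>q. infdist q A \<le> r \<longrightarrow> flow F s q \<subseteq> {y. infdist y A < e}"
proof -
  obtain U where A: "compact A" "A \<noteq> {}" "A \<subseteq> interior U"
    and U: "\<And>e. e > 0 \<Longrightarrow> \<exists>t>0. \<forall>s\<ge>t. (\<Union>p\<in>U. flow F s p) \<subseteq> {y. infdist y A < e}"
    using assms unfolding attractor_def by blast
  \<comment> \<open>Compactness of \<open>A\<close> gives one closed neighbourhood inside the
    attracted set, independent of \<open>e\<close>.\<close>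
  obtain r where r: "r > 0" "(\<Union>x\<in>A. cball x r) \<subseteq> interior U"
    using compact_subset_open_imp_cball_epsilon_subset[OF A(1) open_interior A(3)] by blast
  have U': "q \<in> U" if "infdist q A \<le> r" for q
  proof -
    obtain a where "a \<in> A" "infdist q A = dist q a"
      using infdist_attains_inf[OF compact_imp_closed[OF A(1)] A(2)] by blast
    then have "q \<in> (\<Union>x\<in>A. cball x r)" using that by (auto simp: dist_commute)
    then show ?thesis using r(2) interior_subset by blast
  qed
  have "\<exists>t>0. \<forall>s\<ge>t. \<forall>q. infdist q A \<le> r \<longrightarrow> flow F s q \<subseteq> {y. infdist y A < e}" if "e > 0" for e
    using U[OF that] U' by blast
  then show thesis using that r(1) by blast
qed

text \<open>Boundedness of the forward orbit gives a limit point of late points at distance at least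
  \<open>e\<close> from \<open>A\<close>; it would belong to the omega-limit set and hence to
  \<open>A\<close>.\<close>

lemma basin_enters:
  assumes p: "p \<in> basin F A" and e: "e > 0"
  obtains t where "t \<ge> 0" "\<And>s. s \<ge> t \<Longrightarrow> flow F s p \<subseteq> {y. infdist y A < e}"
proof (rule ccontr)
  assume "\<not> thesis"
  then have no: "\<not> (\<forall>s\<ge>real n. flow F s p \<subseteq> {y. infdist y A < e})" for n
    using that[of "real n"] by auto
  have "\<exists>s y. real n \<le> s \<and> y \<in> flow F s p \<and> e \<le> infdist y A" for n
    using no[of n] by (auto simp: subset_eq not_less)
  then obtain s y where y: "\<And>n. real n \<le> s n" "\<And>n. y n \<in> flow F (s n) p" "\<And>n. e \<le> infdist (y n) A"
    by metis
  have s0: "0 \<le> s n" for n using y(1)[of n] by linarith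
  have "range y \<subseteq> (\<Union>t\<in>{0..}. flow F t p)" using y(2) s0 by auto
  then have "bounded (range y)" using p bounded_subset unfolding basin_def by blast
  then obtain l k where k: "strict_mono (k :: nat \<Rightarrow> nat)" "(y \<circ> k) \<longlonglongrightarrow> l"
    using bounded_imp_convergent_subsequence by blast
  have "l \<in> closure (\<Union>u\<in>{t..}. flow F u p)" for t
  proof (rule Lim_in_closed_set[OF closed_closure _ sequentially_bot k(2)])
    obtain N where N: "t \<le> real N" using real_arch_simple by blast
    have "(y \<circ> k) n \<in> closure (\<Union>u\<in>{t..}. flow F u p)" if n: "N \<le> n" for n
    proof -
      have "real n \<le> real (k n)" using seq_suble[OF k(1), of n] by simp
      moreover have "real N \<le> real n" using n by simp
      ultimately have "t \<le> s (k n)" using y(1)[of "k n"] N by linarith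
      then have "y (k n) \<in> (\<Union>u\<in>{t..}. flow F u p)" using y(2)[of "k n"] by auto
      then show ?thesis unfolding o_def by (rule subsetD[OF closure_subset])
    qed
    then show "\<forall>\<^sub>F n in sequentially. (y \<circ> k) n \<in> closure (\<Union>u\<in>{t..}. flow F u p)"
      unfolding eventually_sequentially by blast
  qed
  then have "l \<in> omega_limit F p" unfolding omega_limit_def by blast
  then have "l \<in> A" using p unfolding basin_def by blast
  moreover have "e \<le> infdist l A"
    by (rule tendsto_lowerbound[OF tendsto_infdist[OF k(2)]]) (use y(3) in auto)
  ultimately show False using e by simp
qed

text \<open>Integrating the indicator of \<open>E\<close> over \<open>B\<close>, a set of the
  sub-algebra, is the same as integrating its conditional expectation.\<close>

lemma (in prob_space) measure_Int_le_if_cond_exp_le: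
  assumes sub: "subalgebra M N" and B: "B \<in> sets N" and E: "E \<in> sets M"
    and c: "AE \<omega> in M. real_cond_exp M N (indicator E) \<omega> \<le> c"
  shows "measure M (B \<inter> E) \<le> c * measure M B"
proof -
  interpret finite_measure_subalgebra M N
    using sub finite_measure_axioms by (intro finite_measure_subalgebra.intro finite_measure_subalgebra_axioms.intro)
  have BM: "B \<in> sets M" using sub B unfolding subalgebra_def by blast
  have intE: "integrable M (indicator E :: 'a \<Rightarrow> real)"
    using E by (intro integrable_real_indicator) (auto simp: emeasure_eq_measure)
  have "measure M (B \<inter> E) = (LINT \<omega>:B|M. indicator E \<omega>)"
    using BM E unfolding set_lebesgue_integral_def
    by (simp add: indicator_inter_arith[symmetric])
  also have "\<dots> = (LINT \<omega>:B|M. real_cond_exp M N (indicator E) \<omega>)"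
    by (rule real_cond_exp_intA[OF intE B])
  also have "\<dots> \<le> (LINT \<omega>:B|M. c)"
    unfolding set_lebesgue_integral_def
    using BM real_cond_exp_int(1)[OF intE]
  proof (intro integral_mono_AE integrable_mult_indicator[OF BM])
    show "AE \<omega> in M. indicator B \<omega> *\<^sub>R real_cond_exp M N (indicator E) \<omega> \<le> indicator B \<omega> *\<^sub>R c"
      using c by eventually_elim (auto simp: indicator_def)
  qed auto
  also have "\<dots> = c * measure M B"
    using BM unfolding set_lebesgue_integral_def by simp
  finally show ?thesis .
qed

theorem theorem2p15:
  fixes P :: "'w measure" and \<F> :: "nat \<Rightarrow> 'w measure"
    and M A :: "(real^'m) set" and F :: "real^'m \<Rightarrow> (real^'m) set"
    and G :: "nat \<Rightarrow> real^'m \<Rightarrow> (real^'m) set"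
    and \<gamma> :: "nat \<Rightarrow> real" and U x :: "nat \<Rightarrow> 'w \<Rightarrow> real^'m"
    and w :: "nat \<Rightarrow> real \<Rightarrow> real \<Rightarrow> real"
  assumes "prob_space P"
    and "filtration (space P) \<F>" and "\<And>n. subalgebra P (\<F> n)"
    and "compact M"
    and "standard_map F"
    and "gen_stoch_approx P \<F> M F G \<gamma> U x"
    and "\<And>n \<epsilon> T. \<epsilon> > 0 \<Longrightarrow> T > 0 \<Longrightarrow> w n \<epsilon> T \<ge> 0"
    and "\<And>\<epsilon> T. \<epsilon> > 0 \<Longrightarrow> T > 0 \<Longrightarrow> decseq (\<lambda>n. w n \<epsilon> T)"
    and "\<And>\<epsilon> T. \<epsilon> > 0 \<Longrightarrow> T > 0 \<Longrightarrow> (\<lambda>n. w n \<epsilon> T) \<longlonglongrightarrow> 0"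
    and "\<And>n \<epsilon> T. \<epsilon> > 0 \<Longrightarrow> T > 0 \<Longrightarrow>
      AE \<omega> in P. real_cond_exp P (\<F> n) (indicator (noise_event P \<gamma> U n \<epsilon> T)) \<omega> \<le> w n \<epsilon> T"
    and "attractor F A"
  shows "attainable P M (interpolated \<gamma> x) \<inter> basin F A \<noteq> {} \<longrightarrow>
    measure P {\<omega>\<in>space P. limit_set (interpolated \<gamma> x \<omega>) \<subseteq> A} > 0"
proof
  assume "attainable P M (interpolated \<gamma> x) \<inter> basin F A \<noteq> {}"
  then obtain p where att: "p \<in> attainable P M (interpolated \<gamma> x)" and p: "p \<in> basin F A" by blast
  interpret prob_space P by fact
  interpret generalised_approximation P \<F> M F G \<gamma> U x by unfold_locales fact+
  have A: "compact A" "A \<noteq> {}" using \<open>attractor F A\<close> by (auto simp: attractor_def)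
  have xF: "x n \<in> borel_measurable (\<F> n)" and UF: "U n \<in> borel_measurable (\<F> n)" for n
    using approx unfolding gen_stoch_approx_def by blast+
  have xP[measurable]: "x n \<in> borel_measurable P" and UP: "U n \<in> borel_measurable P" for n
    using measurable_from_subalg[OF assms(3) xF] measurable_from_subalg[OF assms(3) UF] by auto

  obtain r where r: "r > 0"
    and unif: "\<And>e. e > 0 \<Longrightarrow> \<exists>t>0. \<forall>s\<ge>t. \<forall>q. infdist q A \<le> r \<longrightarrow> flow F s q \<subseteq> {y. infdist y A < e}"
    using attractor_uniform[OF \<open>attractor F A\<close>] by blast
  define B where "B = {y. infdist y A \<le> r}"
  define V where "V e = {y. infdist y A < e}" for e
  have B: "closed B" "B \<noteq> {}"
  proof -
    show "closed B" unfolding B_def by (intro closed_Collect_le continuous_intros)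
    have "A \<subseteq> B" using r by (auto simp: B_def)
    then show "B \<noteq> {}" using A by auto
  qed
  have V: "open (V e)" for e
    unfolding V_def by (intro open_Collect_less continuous_intros)
  have VB: "V r \<subseteq> B" by (auto simp: V_def B_def)
  have unif': "\<exists>t>0. \<forall>s\<ge>t. \<forall>q\<in>B. flow F s q \<subseteq> V e" if "e > 0" for e
    using unif[OF that] by (auto simp: B_def V_def)

  obtain t0 where t0: "t0 > 0" "\<And>s q. q \<in> B \<Longrightarrow> s \<ge> t0 \<Longrightarrow> flow F s q \<subseteq> V r"
    using unif'[OF r] by blast
  obtain J1 e1 where e1: "e1 > 0" and absorb: "\<And>n \<omega>. J1 \<le> n \<Longrightarrow> \<omega> \<in> space P \<Longrightarrow> x n \<omega> \<in> B \<Longrightarrow>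
      (\<And>k. n \<le> k \<Longrightarrow> small_noise \<gamma> U \<omega> k e1 (2 * t0 + 1)) \<Longrightarrow> \<forall>\<^sub>F m in sequentially. x m \<omega> \<in> B"
    using absorption[OF t0(1) B V VB t0(2)] by meson
  obtain T0 where T0: "T0 \<ge> 0" "\<And>s. s \<ge> T0 \<Longrightarrow> flow F s p \<subseteq> V r"
    using basin_enters[OF p r] unfolding V_def by blast
  \<comment> \<open>Shadowing starts from the singleton \<open>{p}\<close>, with a window of length
    1 after \<open>T0\<close>: with steps of at most 1 an iterate falls into it.\<close>
  obtain J2 e2 where e2: "e2 > 0" and enter: "\<And>n \<omega> m. J2 \<le> n \<Longrightarrow> \<omega> \<in> space P \<Longrightarrow> infdist (x n \<omega>) {p} \<le> e2 \<Longrightarrow>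
      small_noise \<gamma> U \<omega> n e2 (T0 + 1) \<Longrightarrow> \<tau> n + T0 \<le> \<tau> m \<Longrightarrow> \<tau> m \<le> \<tau> n + (T0 + 1) \<Longrightarrow> x m \<omega> \<in> V r"
  proof -
    have "\<exists>J. \<exists>e>0. \<forall>n\<ge>J. \<forall>\<omega>\<in>space P. infdist (x n \<omega>) {p} \<le> e \<longrightarrow> small_noise \<gamma> U \<omega> n e (T0 + 1) \<longrightarrow>
      (\<forall>m. \<tau> n + T0 \<le> \<tau> m \<and> \<tau> m \<le> \<tau> n + (T0 + 1) \<longrightarrow> x m \<omega> \<in> V r)"
      by (rule shadowing) (use V T0 in auto)
    then show thesis using that by meson
  qed
  \<comment> \<open>One pair \<open>e\<close>, \<open>T\<close> serves entry and absorption
    together, so a single \<open>noise_event\<close> has to be avoided.\<close>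
  define e where "e = min e1 e2"
  define T where "T = max (T0 + 1) (2 * t0 + 1)"
  have e: "e > 0" "e \<le> e1" "e \<le> e2" and T: "T > 0" "T0 + 1 \<le> T" "2 * t0 + 1 \<le> T"
    using e1 e2 t0 by (auto simp: e_def T_def)
  obtain J3 where J3: "\<And>i. J3 \<le> i \<Longrightarrow> \<gamma> i \<le> 1" using eventually_gamma_le[of 1] by auto
  obtain J4 where J4: "\<And>n. J4 \<le> n \<Longrightarrow> w n e T < 1"
    using order_tendstoD(2)[OF assms(9)[OF e(1) T(1)], of 1] unfolding eventually_sequentially by auto
  obtain n0 R K where RK: "0 \<le> R" "0 \<le> K"
    and step: "\<And>i \<omega>. n0 \<le> i \<Longrightarrow> \<omega> \<in> space P \<Longrightarrow> norm (x (Suc i) \<omega> - x i \<omega>) \<le> (R + K) * \<gamma> (Suc i)"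
    using bounds by metis
  have "e / (2 * (R + K + 1)) > 0" using e RK by simp
  then obtain J5 where J5: "\<And>i. J5 \<le> i \<Longrightarrow> \<gamma> i \<le> e / (2 * (R + K + 1))"
    using eventually_gamma_le by blast
  \<comment> \<open>The successor makes \<open>\<tau> N\<close> positive, as attainability requires
    of its time.\<close>
  define N where "N = Suc (Max {J1, J2, J3, J4, J5, n0})"
  have N: "J1 \<le> N" "J2 \<le> N" "J3 \<le> N" "J4 \<le> N" "J5 \<le> N" "n0 \<le> N" "0 < N"
    unfolding N_def by (auto intro!: le_SucI Max_ge)
  have step_small: "norm (x (Suc i) \<omega> - x i \<omega>) \<le> e / 2" if "N \<le> i" "\<omega> \<in> space P" for i \<omega>
  proof -
    have "norm (x (Suc i) \<omega> - x i \<omega>) \<le> (R + K) * \<gamma> (Suc i)" using step[of i \<omega>] that N by simp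
    also have "\<dots> \<le> (R + K + 1) * \<gamma> (Suc i)" using pos[of "Suc i"] by (intro mult_right_mono) auto
    also have "\<dots> \<le> (R + K + 1) * (e / (2 * (R + K + 1)))"
      using J5[of "Suc i"] that N RK by (intro mult_left_mono) auto
    also have "\<dots> = e / 2" using RK by (simp add: field_simps)
    finally show ?thesis .
  qed

  \<comment> \<open>This event looks at the \<open>n\<close>-th iterate alone and so belongs to
    \<open>\<F> n\<close>, unlike the hitting event, which involves all later times.\<close>
  define near where "near n = {\<omega>\<in>space P. x n \<omega> \<in> ball p e}" for n
  have near_F: "near n \<in> sets (\<F> n)" for n
  proof -
    have "x n -` ball p e \<inter> space (\<F> n) \<in> sets (\<F> n)" using xF by (rule measurable_sets) simp
    moreover have "space (\<F> n) = space P" using assms(3)[of n] by (simp add: subalgebra_def)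
    moreover have "near n = x n -` ball p e \<inter> space P" by (auto simp: near_def)
    ultimately show ?thesis by simp
  qed
  have near_P: "near n \<in> sets P" for n
    using near_F assms(3)[of n] unfolding subalgebra_def by blast
  \<comment> \<open>A path in the ball of radius \<open>e / 2\<close> after time
    \<open>\<tau> N\<close> has an iterate within \<open>e\<close> of \<open>p\<close>, since steps
    are at most \<open>e / 2\<close>. Were all \<open>near n\<close> null, the hitting event would
    lie in a countable union of null sets.\<close>
  have "\<exists>n\<ge>N. measure P (near n) > 0"
  proof (rule ccontr)
    assume "\<not> ?thesis"
    then have "measure P (near n) = 0" if "N \<le> n" for n
      using that by (metis measure_nonneg order_le_less)
    then have "near n \<in> null_sets P" if "n \<in> {N..}" for n
      using that near_P[of n] by (auto simp: null_sets_def emeasure_eq_measure)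
    then have null: "(\<Union>n\<in>{N..}. near n) \<in> null_sets P"
      by (intro null_sets_UN') auto
    have "{\<omega>\<in>space P. \<exists>s\<ge>\<tau> N. interpolated \<gamma> x \<omega> s \<in> ball p (e / 2)} \<subseteq> (\<Union>n\<in>{N..}. near n)"
    proof
      fix \<omega> assume "\<omega> \<in> {\<omega>\<in>space P. \<exists>s\<ge>\<tau> N. interpolated \<gamma> x \<omega> s \<in> ball p (e / 2)}"
      then obtain s where om: "\<omega> \<in> space P" and s: "\<tau> N \<le> s" "dist p (interpolated \<gamma> x \<omega> s) < e / 2" by auto
      obtain i where i: "\<tau> i \<le> s" "s < \<tau> (Suc i)"
        using step_time_bracket[OF tau_lim, of s] tau_nonneg[of N] s(1) by auto
      then have iN: "N \<le> i" using s(1) tau_less_iff[of N "Suc i"] by simp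
      have "dist (interpolated \<gamma> x \<omega> s) (x i \<omega>) \<le> norm (x (Suc i) \<omega> - x i \<omega>)"
        unfolding dist_norm using i pos by (intro norm_interpolated_diff_le) auto
      then have "dist p (x i \<omega>) < e"
        using step_small[OF iN om] s(2) dist_triangle[of p "x i \<omega>" "interpolated \<gamma> x \<omega> s"] by linarith
      then show "\<omega> \<in> (\<Union>n\<in>{N..}. near n)" using om iN by (auto simp: near_def)
    qed
    \<comment> \<open>Monotonicity of \<open>measure\<close> asks only the larger set to be
      measurable.\<close>
    then have "measure P {\<omega>\<in>space P. \<exists>s\<ge>\<tau> N. interpolated \<gamma> x \<omega> s \<in> ball p (e / 2)} \<le> measure P (\<Union>n\<in>{N..}. near n)"
      by (rule finite_measure_mono) (use null in auto)
    also have "\<dots> = 0" using null by (simp add: measure_eq_0_null_sets)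
    finally have "measure P {\<omega>\<in>space P. \<exists>s\<ge>\<tau> N. interpolated \<gamma> x \<omega> s \<in> ball p (e / 2)} \<le> 0" .
    moreover have "\<forall>t>0. \<forall>V. open V \<and> p \<in> V \<longrightarrow>
        measure P {\<omega>\<in>space P. \<exists>s\<ge>t. interpolated \<gamma> x \<omega> s \<in> V} > 0"
      using att unfolding attainable_def by blast
    moreover have "\<tau> N > 0" using tau_less_iff[of 0 N] N by simp
    moreover have "open (ball p (e / 2)) \<and> p \<in> ball p (e / 2)" using e by auto
    ultimately show False by (meson not_le)
  qed
  then obtain n where n: "N \<le> n" and near: "measure P (near n) > 0" by blast
  let ?E = "noise_event P \<gamma> U n e T"
  have E: "?E \<in> sets P" using UP by (rule sets_noise_event)
  have "measure P (near n \<inter> ?E) \<le> w n e T * measure P (near n)"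
    by (rule measure_Int_le_if_cond_exp_le[OF assms(3) near_F E assms(10)[OF e(1) T(1)]])
  also have "\<dots> < measure P (near n)" using J4[of n] N n near by simp
  finally have pos_diff: "measure P (near n - ?E) > 0"
    using finite_measure_Diff'[OF near_P[of n] E] by simp

  let ?S = "{\<omega>\<in>space P. limit_set (interpolated \<gamma> x \<omega>) \<subseteq> A}"
  have "?S = {\<omega>\<in>space P. \<forall>j::nat. \<exists>N. \<forall>m\<ge>N. infdist (x m \<omega>) A < 1 / real (Suc j)}"
    using limit_set_subset_iff[OF _ A] by auto
  moreover have "(\<lambda>\<omega>. infdist (x m \<omega>) A) \<in> borel_measurable P" for m
    by (rule borel_measurable_continuous_on[OF _ xP]) (intro continuous_intros)
  ultimately have S: "?S \<in> sets P" by simp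
  have "AE \<omega> in P. \<omega> \<in> near n - ?E \<longrightarrow> \<omega> \<in> ?S"
    using AE_eventually_small_noise
  proof (rule AE_mp, intro AE_I2 impI)
    fix \<omega> assume om: "\<omega> \<in> space P" and in_diff: "\<omega> \<in> near n - ?E"
      and noise: "\<forall>e T. e > 0 \<longrightarrow> T > 0 \<longrightarrow> (\<forall>\<^sub>F n in sequentially. small_noise \<gamma> U \<omega> n e T)"
    have small: "small_noise \<gamma> U \<omega> k e T" if "n \<le> k" for k
      using in_diff om by (intro small_noise_if_not_noise_event[OF om _ e(1) that]) auto
    obtain m where m: "n \<le> m" "\<tau> n + T0 \<le> \<tau> m" "\<tau> m \<le> \<tau> n + (T0 + 1)"
    proof -
      obtain i where i: "\<tau> i \<le> \<tau> n + T0" "\<tau> n + T0 < \<tau> (Suc i)"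
        using step_time_bracket[OF tau_lim, of "\<tau> n + T0"] tau_nonneg[of n] T0(1) by auto
      then have "n < Suc i" using T0(1) tau_less_iff[of n "Suc i"] by simp
      then show thesis using that[of "Suc i"] i J3[of "Suc i"] n N by (simp add: step_time_Suc)
    qed
    have "x m \<omega> \<in> V r"
    proof (rule enter[OF _ om _ _ m(2,3)])
      show "infdist (x n \<omega>) {p} \<le> e2" using in_diff e by (auto simp: near_def dist_commute)
      show "small_noise \<gamma> U \<omega> n e2 (T0 + 1)" using small_noise_mono[OF small[of n] e(3) T(2)] by simp
    qed (use N n in simp)
    then have "x m \<omega> \<in> B" using VB by blast
    moreover have "small_noise \<gamma> U \<omega> k e1 (2 * t0 + 1)" if "m \<le> k" for k
      using small_noise_mono[OF small[of k] e(2) T(3)] that m(1) by simp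
    ultimately have evB: "\<forall>\<^sub>F m in sequentially. x m \<omega> \<in> B"
      using absorb[of m \<omega>] om m(1) n N by simp
    \<comment> \<open>Outside \<open>?E\<close> the noise is only below the fixed \<open>e\<close>;
      the thresholds depending on \<open>j\<close> come from the almost sure condition.\<close>
    have "\<exists>N. \<forall>m\<ge>N. infdist (x m \<omega>) A < 1 / real (Suc j)" for j
    proof -
      have "1 / real (Suc j) > 0" by simp
      then obtain t where "t > 0" "\<And>s q. q \<in> B \<Longrightarrow> s \<ge> t \<Longrightarrow> flow F s q \<subseteq> V (1 / real (Suc j))"
        using unif' by meson
      from convergence[OF this(1) B V this(2) om evB] noise
      show ?thesis unfolding eventually_sequentially V_def by blast
    qed
    then show "\<omega> \<in> ?S" using limit_set_subset_iff[OF om A] om by blast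
  qed
  then have "measure P (near n - ?E) \<le> measure P ?S"
    using S by (intro finite_measure_mono_AE) auto
  then show "measure P ?S > 0" using pos_diff by linarith
qed

end
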